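(* The regularized cogenus $\gamma_C$ satisfies the following properties, where $X,Y$ denote metrizable, locally convex topological vector spaces. $(I_1)$ $\gamma_C(\emptyset)=0$, and $\gamma_C(A)\in\mathbb{N}$ for any nonempty, symmetric, compact set $A\subset X\setminus\{0\}$. $(I_2)$ If $A\subset X\setminus\{0\}$ is nonempty, symmetric, compact, and $\pi:A\to Y\setminus\{0\}$ is continuous and odd, then $\gamma_C(\pi(A))\ge\gamma_C(A)$. $(I_3)$ If $A\subset X\setminus\{0\}$ is nonempty, symmetric, and compact, then there exists an open subset $U$ of $X\setminus\{0\}$ such that $A\subset U$ and $\gamma_C(\widehat A)\le\gamma_C(A)$ for any nonempty, symmetric, compact set $\widehat A\subset U$. $(I_4)$ If $X$ is a normed space with $1\le\dim X<+\infty$, then $\gamma_C(\{u\in X:\|u\|_X=1\})=\dim X$. Moreover, for any nonempty, symmetric, compact set $A\subset X\setminus\{0\}$, we have $$\gamma_F(A)\le\gamma_C(A)\le\gamma_G(A).$$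
   Context: All vector spaces are real; $\mathbb{N}=\{1,2,\dots\}$; $\mathbb{S}^{m-1}$ is the unit Euclidean sphere in $\mathbb{R}^m$. A set $A$ is symmetric if $x\in A$ implies $-x\in A$. Conventions: $\sup\emptyset=0$, $\inf\emptyset=+\infty$. For a symmetric set $A\subset X\setminus\{0\}$ define: - Krasnoselskii genus: $\gamma_G(A)=\inf\{m\in\mathbb{N}:\text{ there exists a continuous odd map }A\to\mathbb{S}^{m-1}\}$ (for nonempty $A$); - cogenus: $\gamma_F(A)=\sup\{m\in\mathbb{N}:\text{ there exists a continuous odd map }\mathbb{S}^{m-1}\to A\}$; - regularized cogenus: $\gamma_C(A)=\sup\{m\in\mathbb{N}:\text{ for every }U\in\mathcal{N}(A)\text{ there exists a continuous odd map }\mathbb{S}^{m-1}\to U\}$, where $\mathcal{N}(A)$ is the family of open symmetric neighborhoods of $A$ in $X\setminus\{0\}$. Equivalently, $\gamma_C(A)=\inf_{U\in\mathcal{N}(A)}\gamma_F(U)$. *)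

theory Defs
  imports "HOL-Analysis.Analysis" "HOL-Homology.Homology" "HOL-Library.Extended_Nat"
begin

class real_topological_vector = real_vector + topological_ab_group_add +
  assumes tendsto_scaleR_Pair:
    "((\<lambda>p. fst p *\<^sub>R snd p) \<longlongrightarrow> r *\<^sub>R x) (nhds r \<times>\<^sub>F nhds x)"

instance real_normed_vector \<subseteq> real_topological_vector
proof
  show "((\<lambda>p. fst p *\<^sub>R snd p) \<longlongrightarrow> r *\<^sub>R x) (nhds r \<times>\<^sub>F nhds x)" for r and x :: 'a
    by (intro tendsto_scaleR filterlim_fst filterlim_snd)
qed

definition locally_convex :: "'a::real_topological_vector itself \<Rightarrow> bool" where
  "locally_convex _ \<longleftrightarrow>
    (\<forall>U :: 'a set. open U \<and> 0 \<in> U \<longrightarrow> (\<exists>V. open V \<and> convex V \<and> 0 \<in> V \<and> V \<subseteq> U))"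

lemma locally_convex_normed: "locally_convex TYPE('a::real_normed_vector)"
  unfolding locally_convex_def by (meson centre_in_ball convex_ball open_ball open_contains_ball)

definition symmetric_set :: "'a::uminus set \<Rightarrow> bool" where
  "symmetric_set A \<longleftrightarrow> (\<forall>x\<in>A. - x \<in> A)"

definition odd_on :: "'a::uminus set \<Rightarrow> ('a \<Rightarrow> 'b::uminus) \<Rightarrow> bool" where
  "odd_on A f \<longleftrightarrow> (\<forall>x\<in>A. f (- x) = - f x)"

text \<open>
  The unit sphere of \<open>\<real>\<^sup>m\<close> is the library's \<^term>\<open>nsphere (m - 1)\<close>, whose points are functions
  \<open>nat \<Rightarrow> real\<close> vanishing from index \<open>m\<close> on; the unary minus on such functions is pointwise.
  The truncated subtraction is harmless since always \<open>m \<ge> 1\<close>.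
\<close>

definition odd_map_to_sphere :: "'a::{uminus, topological_space} set \<Rightarrow> nat \<Rightarrow> ('a \<Rightarrow> nat \<Rightarrow> real) \<Rightarrow> bool"
  where "odd_map_to_sphere A m f \<longleftrightarrow>
    continuous_map (top_of_set A) (nsphere (m - 1)) f \<and> odd_on A f"

definition odd_map_from_sphere :: "nat \<Rightarrow> 'a::{uminus, topological_space} set \<Rightarrow> ((nat \<Rightarrow> real) \<Rightarrow> 'a) \<Rightarrow> bool"
  where "odd_map_from_sphere m A f \<longleftrightarrow>
    continuous_map (nsphere (m - 1)) (top_of_set A) f \<and> odd_on (topspace (nsphere (m - 1))) f"

text \<open>
  In \<^typ>\<open>enat\<close>, the supremum of the empty set is \<open>0\<close> and its infimum is \<open>\<infinity>\<close>.
  The genus is only meaningful for nonempty sets.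
\<close>

definition genus :: "'a::real_topological_vector set \<Rightarrow> enat" where
  "genus A = Inf {enat m | m. m \<ge> 1 \<and> (\<exists>f. odd_map_to_sphere A m f)}"

definition cogenus :: "'a::real_topological_vector set \<Rightarrow> enat" where
  "cogenus A = Sup {enat m | m. m \<ge> 1 \<and> (\<exists>f. odd_map_from_sphere m A f)}"

definition sym_nbhds :: "'a::real_topological_vector set \<Rightarrow> 'a set set" where
  "sym_nbhds A = {U. openin (top_of_set (- {0})) U \<and> symmetric_set U \<and> A \<subseteq> U}"

definition reg_cogenus :: "'a::real_topological_vector set \<Rightarrow> enat" where
  "reg_cogenus A =
    Sup {enat m | m. m \<ge> 1 \<and> (\<forall>U\<in>sym_nbhds A. \<exists>f. odd_map_from_sphere m U f)}"

definition nonempty_sym_compact :: "'a::real_topological_vector set \<Rightarrow> bool" where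
  "nonempty_sym_compact A \<longleftrightarrow> A \<noteq> {} \<and> A \<subseteq> - {0} \<and> symmetric_set A \<and> compact A"

end

theory Submission
  imports Defs
begin

text \<open>
  The topological input is the Borsuk--Ulam theorem: there is no odd map \<open>f\<close> from \<open>S\<^sup>p\<^sup>+\<^sup>1\<close> to \<open>S\<^sup>p\<close>.
  Write \<open>\<tau>\<close> for the antipodal map. Chains \<open>e\<^sub>n\<close> carried by the upper hemispheres with
  \<open>\<partial>e\<^sub>n\<^sub>+\<^sub>1 = (1 - (-1)\<^sup>n \<tau>) e\<^sub>n\<close> represent the equivariant cell structure of the spheres, and the
  class of \<open>(1 - (-1)\<^sup>p \<tau>) e\<^sub>p\<close> in \<open>H\<^sub>p(S\<^sup>p)\<close> is not divisible by 2. Since the lower reduced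
  homology of \<open>S\<^sup>p\<close> vanishes, \<open>f\<^sub># e\<^sub>p\<close> and \<open>e\<^sub>p\<close> differ, up to a chain killed by \<open>1 - (-1)\<^sup>p \<tau>\<close>,
  by a cycle \<open>z\<close>. As \<open>\<tau>\<close> acts on \<open>H\<^sub>p(S\<^sup>p)\<close> by a sign, \<open>(1 - (-1)\<^sup>p \<tau>) z\<close> is divisible by 2 in homology,
  whereas \<open>(1 - (-1)\<^sup>p \<tau>) f\<^sub># e\<^sub>p = \<partial> f\<^sub># e\<^sub>p\<^sub>+\<^sub>1\<close> is a boundary: a contradiction.

  Consequently \<open>m\<close> odd continuous functions without common zero on \<open>A\<close> bound the regularized
  cogenus by \<open>m\<close>. Finiteness and the bound by the genus follow by producing such functions with
  Urysohn's lemma and Tietze's theorem. For \<open>(I\<^sub>2)\<close>, the map \<open>\<pi>\<close> is approximated on \<open>A\<close> by an odd map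
  defined on a neighbourhood, built from finitely many values of \<open>\<pi>\<close> and a partition of unity.
  Property \<open>(I\<^sub>3)\<close> holds because the finite value \<open>n\<close> is certified by a single neighbourhood that
  receives no odd map from \<open>S\<^sup>n\<close>.
\<close>

section \<open>The Borsuk--Ulam theorem\<close>

lemma fun_uminus_uminus: "- (- x) = (x :: nat \<Rightarrow> real)"
  by (simp add: fun_Compl_def)

lemma continuous_map_nsphere_uminus: "continuous_map (nsphere n) (nsphere n) uminus"
proof -
  have "continuous_map (nsphere n) euclideanreal (\<lambda>x. (- x) i)" for i
    by (simp add: fun_Compl_def continuous_map_minus continuous_map_nsphere_projection)
  then have "continuous_map (nsphere n) (powertop_real UNIV) uminus"
    by (simp add: continuous_map_componentwise_UNIV)
  then show ?thesis
    by (auto simp: nsphere continuous_map_in_subtopology)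
qed

text \<open>The action of 1 + s \<tau> on chains, where \<tau> is the antipodal map. With s
  alternating between 1 and -1, these operators are the differentials of the equivariant cell
  structure of the spheres.\<close>

definition signed_sum :: "int \<Rightarrow> nat \<Rightarrow> (nat \<Rightarrow> real) chain \<Rightarrow> (nat \<Rightarrow> real) chain" where
  "signed_sum s p c = c + frag_cmul s (chain_map p uminus c)"

lemma singular_chain_signed_sum:
  assumes "singular_chain p (nsphere n) c"
  shows "singular_chain p (nsphere n) (signed_sum s p c)"
  unfolding signed_sum_def
  by (intro singular_chain_add singular_chain_cmul
      singular_chain_chain_map[OF assms continuous_map_nsphere_uminus] assms)

lemma signed_sum_diff: "signed_sum s p (a - b) = signed_sum s p a - signed_sum s p b"
proof -
  have "frag_cmul s (x - y) = frag_cmul s x - frag_cmul s y" for x y :: "(nat \<Rightarrow> real) chain"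
    using frag_cmul_distrib2[of s "x - y" y] by (simp add: algebra_simps)
  then show ?thesis
    by (simp add: signed_sum_def chain_map_diff)
qed

lemma chain_boundary_signed_sum:
  assumes "singular_chain (Suc p) X c"
  shows "chain_boundary (Suc p) (signed_sum s (Suc p) c) = signed_sum s p (chain_boundary (Suc p) c)"
  using chain_boundary_chain_map[OF assms, of uminus]
  by (simp add: signed_sum_def chain_boundary_add chain_boundary_cmul)

text \<open>(1 + s \<tau>)(1 - s \<tau>) = 1 - s^2 \<tau>^2 = 0, because \<tau> is an involution and
  s is a sign.\<close>

lemma signed_sum_signed_sum:
  assumes c: "singular_chain p X c" and s: "s * s = 1"
  shows "signed_sum s p (signed_sum (- s) p c) = 0"
proof -
  have "chain_map p (uminus \<circ> uminus) c = c"
    by (rule chain_map_id_gen[OF c]) (simp add: fun_uminus_uminus)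
  then have "chain_map p uminus (chain_map p uminus c) = c"
    by (simp add: chain_map_compose)
  then show ?thesis
    using s by (simp add: signed_sum_def chain_map_add frag_cmul_distrib2 flip: frag_cmul_distrib)
qed

lemma chain_map_signed_sum:
  assumes c: "singular_chain p X c" and f: "\<And>x. x \<in> topspace X \<Longrightarrow> f (- x) = - f x"
  shows "chain_map p f (signed_sum s p c) = signed_sum s p (chain_map p f c)"
proof -
  have "chain_map p (f \<circ> uminus) c = chain_map p (uminus \<circ> f) c"
    by (rule chain_map_eq[OF c]) (simp add: f)
  then show ?thesis
    by (simp add: signed_sum_def chain_map_add chain_map_compose)
qed

section \<open>Reduced cycles and the action of the antipode on the homology of the sphere\<close>

text \<open>The condition in degree 0 says that the augmentation of \<open>c\<close> vanishes.\<close>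

definition reduced_cycle :: "nat \<Rightarrow> 'a topology \<Rightarrow> 'a chain \<Rightarrow> bool" where
  "reduced_cycle p X c \<longleftrightarrow>
    singular_relcycle p X {} c \<and> (p = 0 \<longrightarrow> chain_map 0 (\<lambda>_. ()) c = 0)"

lemma reduced_cycle_class:
  assumes "reduced_cycle p X c"
  shows "homologous_rel_set p X {} c \<in> carrier (reduced_homology_group p X)"
proof -
  have c: "singular_relcycle p X {} c"
    using assms by (simp add: reduced_cycle_def)
  then have H: "homologous_rel_set p X {} c \<in> carrier (homology_group p X)"
    by (auto simp: carrier_relative_homology_group)
  show ?thesis
  proof (cases "p = 0")
    case True
    have "hom_induced p X {} (discrete_topology {()}) {} (\<lambda>x. ()) (homologous_rel_set p X {} c)
        = homologous_rel_set p (discrete_topology {()}) {} (chain_map p (\<lambda>_. ()) c)"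
      by (rule hom_induced_chain_map) (use c in auto)
    also have "\<dots> = \<one>\<^bsub>homology_group p (discrete_topology {()})\<^esub>"
      using assms True homologous_rel_set_eq_relboundary[of 0 "discrete_topology {()}" "{}" 0]
        one_relative_homology_group[of 0 "discrete_topology {()}" "{}"]
      by (simp add: reduced_cycle_def)
    finally show ?thesis
      using H by (simp add: carrier_reduced_homology_group kernel_def)
  qed (use H in \<open>simp add: un_reduced_homology_group\<close>)
qed

lemma reduced_cycle_imp_boundary:
  assumes "trivial_group (reduced_homology_group p X)" "reduced_cycle p X c"
  shows "singular_relboundary p X {} c"
proof -
  have "homologous_rel_set p X {} c = \<one>\<^bsub>reduced_homology_group p X\<^esub>"
    using reduced_cycle_class[OF assms(2)] assms(1) by (auto simp: trivial_group_def)
  then show ?thesis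
    by (simp add: one_reduced_homology_group homologous_rel_set_eq_relboundary)
qed

text \<open>The group operation is the elementwise sum of cosets. The nontrivial inclusion splits x
  as a + (x - a), with x - a in the class of b.\<close>

lemma homologous_rel_set_mult:
  "homologous_rel_set p X S a \<otimes>\<^bsub>relative_homology_group (int p) X S\<^esub> homologous_rel_set p X S b
    = homologous_rel_set p X S (a + b)"
proof (rule subset_antisym; rule subsetI)
  fix x
  assume "x \<in> homologous_rel_set p X S a \<otimes>\<^bsub>relative_homology_group (int p) X S\<^esub> homologous_rel_set p X S b"
  then obtain r s where "homologous_rel p X S a r" "homologous_rel p X S b s" "x = r + s"
    by (auto simp: mult_relative_homology_group)
  then show "x \<in> homologous_rel_set p X S (a + b)"
    by (simp add: homologous_rel_add)
next
  fix x
  assume "x \<in> homologous_rel_set p X S (a + b)"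
  then have "homologous_rel p X S b (x - a)"
    by (simp add: homologous_rel_def algebra_simps)
  moreover have "x = a + (x - a)"
    by simp
  ultimately show "x \<in> homologous_rel_set p X S a \<otimes>\<^bsub>relative_homology_group (int p) X S\<^esub> homologous_rel_set p X S b"
    unfolding mult_relative_homology_group using homologous_rel_refl by blast
qed

text \<open>The antipode acts on the reduced homology of \<open>nsphere p\<close> in degree p
  through its degree D. Being an involution, it has D * D = 1, so D is a sign; its value is left
  open.\<close>

lemma homologous_rel_chain_map_uminus:
  assumes z: "reduced_cycle p (nsphere p) z"
  shows "singular_relboundary p (nsphere p) {} (chain_map p uminus z - z)
       \<or> singular_relboundary p (nsphere p) {} (chain_map p uminus z + z)"
proof -
  let ?G = "reduced_homology_group p (nsphere p)"
  let ?cl = "homologous_rel_set p (nsphere p) {}"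
  interpret G: group ?G by simp
  define D where "D = Brouwer_degree2 p uminus"
  have "D * D = Brouwer_degree2 p (uminus \<circ> uminus)"
    unfolding D_def
    by (rule Brouwer_degree2_compose[OF continuous_map_nsphere_uminus continuous_map_nsphere_uminus, symmetric])
  also have "uminus \<circ> uminus = (id :: (nat \<Rightarrow> real) \<Rightarrow> _)"
    by (rule ext) (simp add: fun_uminus_uminus)
  finally have D: "D = 1 \<or> D = - 1"
    by (simp only: Brouwer_degree2_id zmult_eq_1_iff) auto
  have zG: "?cl z \<in> carrier ?G"
    by (rule reduced_cycle_class[OF z])
  have "?cl (chain_map p uminus z) = hom_induced p (nsphere p) {} (nsphere p) {} uminus (?cl z)"
    using z by (simp add: reduced_cycle_def hom_induced_chain_map continuous_map_nsphere_uminus)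
  also have "\<dots> = ?cl z [^]\<^bsub>?G\<^esub> D"
    unfolding D_def by (rule Brouwer_degree2[OF zG])
  finally have eq: "?cl (chain_map p uminus z) = ?cl z [^]\<^bsub>?G\<^esub> D" .
  from D show ?thesis
  proof
    assume "D = 1"
    with eq zG have "?cl (chain_map p uminus z) = ?cl z" by simp
    then have "homologous_rel p (nsphere p) {} (chain_map p uminus z) z"
      using homologous_rel_refl by blast
    then show ?thesis by (simp add: homologous_rel_def)
  next
    assume "D = - 1"
    with eq zG have "?cl (chain_map p uminus z) \<otimes>\<^bsub>?G\<^esub> ?cl z = \<one>\<^bsub>?G\<^esub>"
      by (simp add: G.int_pow_neg)
    then have "?cl (chain_map p uminus z + z) = \<one>\<^bsub>?G\<^esub>"
      by (simp add: reduced_homology_group_def homologous_rel_set_mult)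
    then show ?thesis
      by (simp add: one_reduced_homology_group homologous_rel_set_eq_relboundary)
  qed
qed

section \<open>Hemispheres and excision at the level of chains\<close>

lemma subtopology_upper_hemisphere_equator:
  "subtopology (subtopology (nsphere (Suc n)) {x. x (Suc n) \<ge> 0}) {x. x (Suc n) = 0} = nsphere n"
proof -
  have "{x. 0 \<le> x (Suc n)} \<inter> {x. x (Suc n) = 0} = {x. x (Suc n) = (0::real)}"
    by auto
  then show ?thesis
    by (simp add: subtopology_nsphere_equator subtopology_subtopology)
qed

lemma singular_chain_nsphere_Suc:
  assumes "singular_chain p (nsphere n) c"
  shows "singular_chain p (nsphere (Suc n)) c"
proof -
  have "singular_chain p (subtopology (nsphere (Suc n)) {x. x (Suc n) = 0}) c"
    using assms by (subst subtopology_nsphere_equator)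
  then show ?thesis
    by (simp add: singular_chain_subtopology)
qed

lemma singular_chain_nsphere_mono:
  assumes "singular_chain p (nsphere m) c" "m \<le> n"
  shows "singular_chain p (nsphere n) c"
  using assms(2,1) by (induction rule: dec_induct) (auto intro: singular_chain_nsphere_Suc)

text \<open>Surjectivity of the excision isomorphism from (upper hemisphere, equator) to (sphere,
  lower hemisphere), stated for representatives.\<close>

lemma relcycle_hemisphere:
  fixes n p :: nat
  defines "U \<equiv> subtopology (nsphere n) {x. x n \<ge> 0}"
  assumes c: "singular_relcycle p (nsphere n) {x. x n \<le> 0} c"
  obtains c' where "singular_relcycle p U {x. x n = 0} c'"
    "singular_relboundary p (nsphere n) {x. x n \<le> 0} (c - c')"
proof -
  let ?L = "{x :: nat \<Rightarrow> real. x n \<le> 0}" and ?E = "{x :: nat \<Rightarrow> real. x n = 0}"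
  let ?h = "hom_induced p U ?E (nsphere n) ?L id"
  have iso: "?h \<in> iso (relative_homology_group p U ?E) (relative_homology_group p (nsphere n) ?L)"
    unfolding U_def by (rule iso_relative_homology_group_upper_hemisphere)
  then have onto: "?h ` carrier (relative_homology_group p U ?E) = carrier (relative_homology_group p (nsphere n) ?L)"
    by (simp add: iso_iff)
  have cm: "continuous_map U (nsphere n) id"
    by (simp add: U_def continuous_map_from_subtopology)
  have "homologous_rel_set p (nsphere n) ?L c \<in> carrier (relative_homology_group p (nsphere n) ?L)"
    unfolding carrier_relative_homology_group using c by (intro imageI) simp
  then obtain c' where c': "singular_relcycle p U ?E c'"
    and eq: "homologous_rel_set p (nsphere n) ?L c = ?h (homologous_rel_set p U ?E c')"
    unfolding onto[symmetric] unfolding carrier_relative_homology_group by blast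
  have "?h (homologous_rel_set p U ?E c') = homologous_rel_set p (nsphere n) ?L (chain_map p id c')"
    by (rule hom_induced_chain_map[OF cm _ c']) auto
  moreover have "chain_map p id c' = c'"
    using c' unfolding singular_relcycle by (intro chain_map_ident[of _ U]) simp
  ultimately have "homologous_rel p (nsphere n) ?L c c'"
    using eq by (simp only: homologous_rel_set_eq)
  with c' that show ?thesis by (simp add: homologous_rel_def)
qed

text \<open>Injectivity of the same isomorphism, stated for representatives.\<close>

lemma relboundary_hemisphere:
  fixes n p :: nat
  defines "U \<equiv> subtopology (nsphere n) {x. x n \<ge> 0}"
  assumes c: "singular_relcycle p U {x. x n = 0} c"
    and b: "singular_relboundary p (nsphere n) {x. x n \<le> 0} c"
  shows "singular_relboundary p U {x. x n = 0} c"
proof -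
  let ?L = "{x :: nat \<Rightarrow> real. x n \<le> 0}" and ?E = "{x :: nat \<Rightarrow> real. x n = 0}"
  let ?h = "hom_induced p U ?E (nsphere n) ?L id"
  have iso: "?h \<in> iso (relative_homology_group p U ?E) (relative_homology_group p (nsphere n) ?L)"
    unfolding U_def by (rule iso_relative_homology_group_upper_hemisphere)
  then have inj: "inj_on ?h (carrier (relative_homology_group p U ?E))"
    by (simp add: iso_iff)
  have cm: "continuous_map U (nsphere n) id"
    by (simp add: U_def continuous_map_from_subtopology)
  have eq: "?h (homologous_rel_set p U ?E a) = homologous_rel_set p (nsphere n) ?L a"
    if a: "singular_relcycle p U ?E a" for a
  proof -
    have "?h (homologous_rel_set p U ?E a) = homologous_rel_set p (nsphere n) ?L (chain_map p id a)"
      by (rule hom_induced_chain_map[OF cm _ a]) auto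
    moreover have "chain_map p id a = a"
      using a unfolding singular_relcycle by (intro chain_map_ident[of _ U]) simp
    ultimately show ?thesis by simp
  qed
  have "?h (homologous_rel_set p U ?E c) = ?h (homologous_rel_set p U ?E 0)"
    unfolding eq[OF c] eq[OF singular_relcycle_0] homologous_rel_set_eq
    using b by (simp add: homologous_rel_def)
  then have "homologous_rel_set p U ?E c = homologous_rel_set p U ?E 0"
  proof (rule inj_onD[OF inj])
    show "homologous_rel_set p U ?E c \<in> carrier (relative_homology_group p U ?E)"
      unfolding carrier_relative_homology_group using c by (intro imageI) simp
    show "homologous_rel_set p U ?E 0 \<in> carrier (relative_homology_group p U ?E)"
      unfolding carrier_relative_homology_group by (intro imageI) simp
  qed
  then have "homologous_rel p U ?E c 0"
    by (simp only: homologous_rel_set_eq)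
  then show ?thesis
    by (simp add: homologous_rel_def)
qed

section \<open>Chains carried by the upper hemispheres\<close>

text \<open>
  Candidates for \<open>e\<^sub>n\<close>. The final clause keeps the half cycle nontrivial: adding its signed antipode
  gives a cycle that is not divisible by 2 in homology.
\<close>

definition half_cycle :: "nat \<Rightarrow> (nat \<Rightarrow> real) chain \<Rightarrow> bool" where
  "half_cycle n e \<longleftrightarrow>
    singular_chain n (nsphere n) e \<and>
    chain_boundary n (signed_sum ((-1) ^ Suc n) n e) = 0 \<and>
    (n = 0 \<longrightarrow> chain_map 0 (\<lambda>_. ()) e = frag_of (restrict (\<lambda>_. ()) (standard_simplex 0))) \<and>
    (\<forall>c. singular_relcycle n (nsphere n) {} c \<longrightarrow>
      \<not> singular_relboundary n (nsphere n) {} (signed_sum ((-1) ^ Suc n) n e - frag_cmul 2 c))"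

text \<open>A singular 1-simplex in the two-point space is constant, since its domain is connected;
  hence its two faces cancel.\<close>

lemma chain_boundary_nsphere_0:
  assumes "singular_chain (Suc 0) (nsphere 0) d"
  shows "chain_boundary (Suc 0) d = 0"
  using assms unfolding singular_chain_def
proof (induction d rule: frag_induction)
  case (one f)
  let ?S = "standard_simplex (Suc 0)"
  have cm: "continuous_map (subtopology (powertop_real UNIV) ?S) (nsphere 0) f"
    using one by (simp add: singular_simplex_def)
  have sq: "(f t 0)\<^sup>2 = 1" "\<forall>i>0. f t i = 0" if "t \<in> ?S" for t
  proof -
    have "f t \<in> topspace (nsphere 0)"
      using cm that by (auto simp: continuous_map_def)
    then show "(f t 0)\<^sup>2 = 1" "\<forall>i>0. f t i = 0"
      by (auto simp: nsphere)
  qed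
  have "connected ((\<lambda>t. f t 0) ` ?S)"
  proof -
    have "continuous_map (subtopology (powertop_real UNIV) ?S) euclideanreal ((\<lambda>x. x 0) \<circ> f)"
      by (rule continuous_map_compose[OF cm continuous_map_nsphere_projection])
    then have "connectedin euclideanreal (((\<lambda>x. x 0) \<circ> f) ` ?S)"
      by (rule connectedin_continuous_map_image)
        (simp add: connectedin_subtopology connectedin_standard_simplex)
    then show ?thesis
      by (simp add: image_comp)
  qed
  moreover have "finite ((\<lambda>t. f t 0) ` ?S)"
    by (rule finite_subset[of _ "{1, -1}"]) (use sq in \<open>auto simp: power2_eq_1_iff\<close>)
  ultimately have fin: "connected ((\<lambda>t. f t 0) ` ?S)" "finite ((\<lambda>t. f t 0) ` ?S)"
    by auto
  have const: "f s 0 = f t 0" if "s \<in> ?S" "t \<in> ?S" for s t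
  proof -
    have "f s 0 \<in> (\<lambda>t. f t 0) ` ?S" "f t 0 \<in> (\<lambda>t. f t 0) ` ?S"
      using that by auto
    moreover obtain a where "(\<lambda>t. f t 0) ` ?S \<subseteq> {a}"
      using fin by (auto simp: connected_finite_iff_sing)
    ultimately show ?thesis
      by blast
  qed
  have "f s = f t" if "s \<in> ?S" "t \<in> ?S" for s t
  proof
    show "f s i = f t i" for i
      using const[OF that] sq(2)[OF that(1)] sq(2)[OF that(2)] by (cases "i = 0") auto
  qed
  then have "singular_face (Suc 0) 0 f = singular_face (Suc 0) (Suc 0) f"
    unfolding singular_face_def
    by (intro restrict_ext) (simp add: simplical_face_in_standard_simplex)
  then show ?case
    by (simp add: chain_boundary_of)
qed (auto simp: chain_boundary_diff)

text \<open>The point 1 of \<open>nsphere 0\<close> serves as the first half cycle. Boundaries of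
  1-chains vanish here, so divisibility in homology means equality of chains, and the coefficient 1
  of the simplex in its signed sum is odd.\<close>

lemma half_cycle_0: "\<exists>e. half_cycle 0 e"
proof -
  let ?x = "\<lambda>i::nat. if i = 0 then 1 else 0 :: real"
  define f where "f = restrict (\<lambda>_. ?x) (standard_simplex 0)"
  have f: "singular_simplex 0 (nsphere 0) f"
    using in_topspace_nsphere[of 0] by (simp add: f_def singular_simplex_def)
  let ?s = "signed_sum ((-1) ^ Suc 0) 0 (frag_of f)"
  have "simplex_map 0 uminus f \<noteq> f"
  proof
    assume eq: "simplex_map 0 uminus f = f"
    obtain t where t: "t \<in> standard_simplex 0"
      using nonempty_standard_simplex by blast
    have "simplex_map 0 uminus f t 0 = f t 0"
      using eq by simp
    then show False
      using t by (simp add: f_def simplex_map_def)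
  qed
  then have look: "Poly_Mapping.lookup ?s f = 1"
    by (simp add: signed_sum_def lookup_minus)
  have "\<not> singular_relboundary 0 (nsphere 0) {} (?s - frag_cmul 2 c)" for c
  proof
    assume "singular_relboundary 0 (nsphere 0) {} (?s - frag_cmul 2 c)"
    then have "?s = frag_cmul 2 c"
      by (auto simp: singular_boundary chain_boundary_nsphere_0)
    then have "Poly_Mapping.lookup ?s f = 2 * Poly_Mapping.lookup c f"
      by simp
    then show False
      using look by presburger
  qed
  moreover have "chain_map 0 (\<lambda>_. ()) (frag_of f) = frag_of (restrict (\<lambda>_. ()) (standard_simplex 0))"
    by (simp add: simplex_map_def f_def restrict_def fun_eq_iff)
  ultimately have "half_cycle 0 (frag_of f)"
    using f by (simp add: half_cycle_def singular_chain_of chain_boundary_def)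
  then show ?thesis ..
qed

text \<open>
  The antipode of \<open>e'\<close> lies in the lower hemisphere, so modulo that hemisphere only \<open>e'\<close> survives;
  by excision and the boundary map, divisibility by 2 would descend to the equator.
\<close>

lemma half_cycle_Suc:
  assumes e: "half_cycle n e"
  shows "\<exists>e'. half_cycle (Suc n) e' \<and> chain_boundary (Suc n) e' = signed_sum ((-1) ^ Suc n) n e"
proof -
  define U where "U = subtopology (nsphere (Suc n)) {x. x (Suc n) \<ge> 0}"
  define s :: int where "s = (-1) ^ Suc n"
  let ?L = "{x :: nat \<Rightarrow> real. x (Suc n) \<le> 0}" and ?E = "{x :: nat \<Rightarrow> real. x (Suc n) = 0}"
  have ss: "s * s = 1"
    by (simp add: s_def flip: power_mult_distrib)
  have eq: "subtopology U ?E = nsphere n"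
    unfolding U_def by (rule subtopology_upper_hemisphere_equator)
  have en: "singular_chain n (nsphere n) e" and bn: "chain_boundary n (signed_sum s n e) = 0"
    using e by (simp_all add: half_cycle_def s_def)
  have sn: "singular_chain n (nsphere n) (signed_sum s n e)"
    by (rule singular_chain_signed_sum[OF en])
  have U: "singular_chain p U c" if "singular_chain p (nsphere n) c" for p c
    using that unfolding eq[symmetric] by (simp add: singular_chain_subtopology)
  have S: "singular_chain p (nsphere (Suc n)) c" if "singular_chain p U c" for p c
    using that unfolding U_def by (simp add: singular_chain_subtopology)
  \<comment> \<open>The hemisphere is contractible, so the signed sum bounds a chain e' in it. In
    degree 0 the sign s is -1, and the augmentations of e and of its antipode cancel.\<close>
  have "reduced_cycle n U (signed_sum s n e)"
    unfolding reduced_cycle_def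
  proof (intro conjI impI)
    show "singular_relcycle n U {} (signed_sum s n e)"
      using U[OF sn] bn by (simp add: singular_cycle)
    assume n: "n = 0"
    have "chain_map 0 (\<lambda>_. ()) (chain_map 0 uminus e) = chain_map 0 (\<lambda>_. ()) e"
      by (simp flip: chain_map_compose[THEN fun_cong, unfolded o_apply] add: o_def)
    then show "chain_map 0 (\<lambda>_. ()) (signed_sum s n e) = 0"
      by (simp add: n signed_sum_def chain_map_add chain_map_diff s_def)
  qed
  moreover have "trivial_group (reduced_homology_group n U)"
    unfolding U_def
    by (intro trivial_reduced_homology_group_contractible_space contractible_space_upper_hemisphere) simp
  ultimately obtain e' where e': "singular_chain (Suc n) U e'" "chain_boundary (Suc n) e' = signed_sum s n e"
    using reduced_cycle_imp_boundary singular_boundary by metis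
  have relcyc: "singular_relcycle (Suc n) U ?E e'"
    using e' sn by (simp add: singular_relcycle eq)
  let ?t = "chain_map (Suc n) uminus e'"
  have t: "singular_relboundary (Suc n) (nsphere (Suc n)) ?L ?t"
  proof (rule singular_chain_imp_relboundary)
    have "continuous_map U (subtopology (nsphere (Suc n)) ?L) uminus"
      unfolding U_def continuous_map_in_subtopology
      using continuous_map_nsphere_uminus by (auto intro: continuous_map_from_subtopology)
    then show "singular_chain (Suc n) (subtopology (nsphere (Suc n)) ?L) ?t"
      by (rule singular_chain_chain_map[OF e'(1)])
  qed
  have "\<not> singular_relboundary (Suc n) (nsphere (Suc n)) {} (signed_sum (- s) (Suc n) e' - frag_cmul 2 c)"
    if c: "singular_relcycle (Suc n) (nsphere (Suc n)) {} c" for c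
  proof
    assume b: "singular_relboundary (Suc n) (nsphere (Suc n)) {} (signed_sum (- s) (Suc n) e' - frag_cmul 2 c)"
    have mono: "singular_relboundary (Suc n) (nsphere (Suc n)) ?L x"
      if "singular_relboundary (Suc n) (nsphere (Suc n)) {} x" for x
      using singular_relboundary_chain_map[OF that continuous_map_id, of ?L]
        chain_map_ident[OF singular_boundary_imp_chain[OF that]] by simp
    have "singular_relcycle (Suc n) (nsphere (Suc n)) ?L c"
      using c by (simp add: singular_cycle) (simp add: singular_relcycle)
    then obtain c' where c': "singular_relcycle (Suc n) U ?E c'"
      and cc': "singular_relboundary (Suc n) (nsphere (Suc n)) ?L (c - c')"
      unfolding U_def by (rule relcycle_hemisphere)
    \<comment> \<open>Each of the three summands is a boundary modulo the lower hemisphere: the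
      first by assumption, the second by the choice of c', the third because the antipode of e' lies
      there.\<close>
    have "e' - frag_cmul 2 c' = (signed_sum (- s) (Suc n) e' - frag_cmul 2 c)
        + frag_cmul 2 (c - c') + frag_cmul s ?t"
    proof -
      have "frag_cmul 2 c = frag_cmul 2 (c - c') + frag_cmul 2 c'"
        by (simp flip: frag_cmul_distrib2)
      moreover have "frag_cmul (- s) ?t + frag_cmul s ?t = 0"
        by (simp flip: frag_cmul_distrib)
      ultimately show ?thesis
        by (simp add: signed_sum_def algebra_simps)
    qed
    then have "singular_relboundary (Suc n) (nsphere (Suc n)) ?L (e' - frag_cmul 2 c')"
      using mono[OF b] cc' t by (simp add: singular_relboundary_add singular_relboundary_cmul)
    moreover have "singular_relcycle (Suc n) U ?E (e' - frag_cmul 2 c')"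
      by (intro singular_relcycle_diff singular_relcycle_cmul relcyc c')
    ultimately have "singular_relboundary (Suc n) U ?E (e' - frag_cmul 2 c')"
      unfolding U_def using relboundary_hemisphere by blast
    \<comment> \<open>This computes the connecting map to the equator: taking boundaries in
      \<open>dx\<close> removes d, and the boundary of x exhibits the signed sum of e as twice a
      cycle, against the last clause of \<open>half_cycle\<close>.\<close>
    then obtain d x where d: "singular_chain (Suc (Suc n)) U d"
      and x: "singular_chain (Suc n) (nsphere n) x"
      and dx: "chain_boundary (Suc (Suc n)) d + x = e' - frag_cmul 2 c'"
      by (auto simp: singular_relboundary eq)
    have "chain_boundary (Suc n) (chain_boundary (Suc (Suc n)) d) = 0"
      using chain_boundary_boundary_alt[OF d] by simp
    then have "chain_boundary (Suc n) x = chain_boundary (Suc n) (chain_boundary (Suc (Suc n)) d + x)"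
      by (simp add: chain_boundary_add)
    also have "\<dots> = signed_sum s n e - frag_cmul 2 (chain_boundary (Suc n) c')"
      unfolding dx by (simp add: chain_boundary_diff chain_boundary_cmul e')
    finally have "singular_relboundary n (nsphere n) {} (signed_sum s n e - frag_cmul 2 (chain_boundary (Suc n) c'))"
      using x by (auto simp: singular_boundary)
    moreover have "singular_relcycle n (nsphere n) {} (chain_boundary (Suc n) c')"
    proof -
      have "singular_chain (Suc n) U c'" "singular_chain n (nsphere n) (chain_boundary (Suc n) c')"
        using c' by (simp_all add: singular_relcycle eq)
      then show ?thesis
        using chain_boundary_boundary[of "Suc n" U c'] by (simp add: singular_cycle)
    qed
    ultimately show False
      using e by (simp add: half_cycle_def s_def)
  qed
  moreover have "chain_boundary (Suc n) (signed_sum (- s) (Suc n) e') = 0"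
    using signed_sum_signed_sum[OF en, of "- s"] ss
    by (simp add: chain_boundary_signed_sum[OF e'(1)] e'(2))
  moreover have "(-1) ^ Suc (Suc n) = - s"
    by (simp add: s_def)
  ultimately have "half_cycle (Suc n) e'"
    unfolding half_cycle_def using S[OF e'(1)] by simp
  with e'(2) show ?thesis
    unfolding s_def by blast
qed

lemma half_cycles:
  obtains e where "\<And>n. half_cycle n (e n)"
    "\<And>n. chain_boundary (Suc n) (e (Suc n)) = signed_sum ((-1) ^ Suc n) n (e n)"
  using dependent_nat_choice[of half_cycle "\<lambda>n x y. chain_boundary (Suc n) y = signed_sum ((-1) ^ Suc n) n x",
      OF half_cycle_0 half_cycle_Suc] by metis

section \<open>Odd maps between spheres of different dimensions\<close>

theorem Borsuk_Ulam_nsphere_Suc: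
  assumes f: "continuous_map (nsphere (Suc p)) (nsphere p) f"
    and odd: "\<And>x. x \<in> topspace (nsphere (Suc p)) \<Longrightarrow> f (- x) = - f x"
  shows False
proof -
  obtain e where e: "\<And>n. half_cycle n (e n)"
    and be: "\<And>n. chain_boundary (Suc n) (e (Suc n)) = signed_sum ((-1) ^ Suc n) n (e n)"
    using half_cycles by blast
  have ch: "singular_chain n (nsphere m) (e n)" if "n \<le> m" for n m
    using e[of n] that by (auto simp: half_cycle_def intro: singular_chain_nsphere_mono)
  define d where "d n = chain_map n f (e n)" for n
  have d: "singular_chain n (nsphere p) (d n)" if "n \<le> Suc p" for n
    unfolding d_def by (rule singular_chain_chain_map[OF ch[OF that] f])
  have bd: "chain_boundary (Suc n) (d (Suc n)) = signed_sum ((-1) ^ Suc n) n (d n)" if "n \<le> p" for n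
  proof -
    have "chain_boundary (Suc n) (d (Suc n)) = chain_map n f (signed_sum ((-1) ^ Suc n) n (e n))"
      using chain_boundary_chain_map[OF ch, of "Suc n" "Suc p" f] that by (simp add: d_def be)
    also have "\<dots> = signed_sum ((-1) ^ Suc n) n (d n)"
      unfolding d_def
      by (rule chain_map_signed_sum[of n "nsphere (Suc p)"]) (use that ch odd in auto)
    finally show ?thesis .
  qed
  have ones: "(-1) ^ n * (-1) ^ n = (1::int)" for n :: nat
    by (simp flip: power_mult_distrib)
  \<comment> \<open>An equivariant chain homotopy from the chains e to their images under f, built
    by degree: below degree p the cycle left over is a boundary, and the chain filling it serves as
    h one degree higher.\<close>
  have "\<exists>h. singular_chain n (nsphere p) h \<and>
      reduced_cycle n (nsphere p) (d n - e n - signed_sum ((-1) ^ n) n h)" if "n \<le> p" for n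
    using that
  proof (induction n)
    case 0
    have "chain_map 0 (\<lambda>_. ()) (d 0) = chain_map 0 (\<lambda>_. ()) (e 0)"
      by (simp add: d_def o_def flip: chain_map_compose[THEN fun_cong, unfolded o_apply])
    then have "reduced_cycle 0 (nsphere p) (d 0 - e 0)"
      using d[of 0] ch[of 0 p]
      by (simp add: reduced_cycle_def singular_cycle chain_boundary_def chain_map_diff singular_chain_diff)
    then show ?case
      by (intro exI[of _ 0]) (simp add: signed_sum_def)
  next
    case (Suc n)
    then obtain h where h: "singular_chain n (nsphere p) h"
      and rc: "reduced_cycle n (nsphere p) (d n - e n - signed_sum ((-1) ^ n) n h)"
      by auto
    have "trivial_group (reduced_homology_group n (nsphere p))"
      using Suc by (simp add: trivial_reduced_homology_group_nsphere)
    from reduced_cycle_imp_boundary[OF this rc]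
    obtain k where k: "singular_chain (Suc n) (nsphere p) k"
      and bk: "chain_boundary (Suc n) k = d n - e n - signed_sum ((-1) ^ n) n h"
      by (auto simp: singular_boundary)
    \<comment> \<open>The terms in d and e cancel, leaving two signed sums of opposite sign applied
      to h.\<close>
    have "chain_boundary (Suc n) (d (Suc n) - e (Suc n) - signed_sum ((-1) ^ Suc n) (Suc n) k)
        = signed_sum ((-1) ^ Suc n) n (signed_sum (- ((-1) ^ Suc n)) n h)"
      using Suc.prems
      by (simp only: chain_boundary_diff bd be chain_boundary_signed_sum[OF k] bk signed_sum_diff)
        (simp add: algebra_simps)
    also have "\<dots> = 0"
      by (rule signed_sum_signed_sum[OF h ones])
    finally have "reduced_cycle (Suc n) (nsphere p) (d (Suc n) - e (Suc n) - signed_sum ((-1) ^ Suc n) (Suc n) k)"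
      using d[of "Suc n"] ch[of "Suc n" p] singular_chain_signed_sum[OF k] Suc.prems
      by (simp add: reduced_cycle_def singular_cycle singular_chain_diff)
    with k show ?case by blast
  qed
  then obtain h where h: "singular_chain p (nsphere p) h"
    and rc: "reduced_cycle p (nsphere p) (d p - e p - signed_sum ((-1) ^ p) p h)"
    by blast
  define z where "z = d p - e p - signed_sum ((-1) ^ p) p h"
  define s :: int where "s = (-1) ^ Suc p"
  have z: "singular_relcycle p (nsphere p) {} z"
    using rc by (simp add: z_def reduced_cycle_def)
  \<comment> \<open>The sign in front of h inside z is -s, so the term in h dies. The term in d
    becomes the boundary of \<open>d (Suc p)\<close>, the image of the top half cycle of the source
    sphere.\<close>
  have "signed_sum s p z = chain_boundary (Suc p) (d (Suc p)) - signed_sum s p (e p)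
      - signed_sum s p (signed_sum (- s) p h)"
    unfolding z_def by (simp only: signed_sum_diff bd[OF order_refl] s_def) simp
  also have "signed_sum s p (signed_sum (- s) p h) = 0"
    unfolding s_def by (rule signed_sum_signed_sum[OF h ones])
  finally have sz: "signed_sum s p (e p) = chain_boundary (Suc p) (d (Suc p)) - signed_sum s p z"
    by simp
  have bdry: "singular_relboundary p (nsphere p) {} (chain_boundary (Suc p) (d (Suc p)))"
    using d[of "Suc p"] by (auto simp: singular_boundary)
  have "\<exists>y. singular_relcycle p (nsphere p) {} y \<and>
      singular_relboundary p (nsphere p) {} (signed_sum s p z - frag_cmul 2 y)"
  proof -
    \<comment> \<open>Here r is the sign by which the antipode acts on the class of z. Thus (1 + s
      \<tau>) z is homologous to (1 + r s) z, which is 2 z or 0, and y is z or 0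
      accordingly.\<close>
    consider (same) r where "r * r = 1" "r * s = 1"
        "singular_relboundary p (nsphere p) {} (chain_map p uminus z - frag_cmul r z)"
      | (opp) r where "r * r = 1" "r * s = -1"
        "singular_relboundary p (nsphere p) {} (chain_map p uminus z - frag_cmul r z)"
    proof -
      have "s = 1 \<or> s = -1"
        unfolding s_def using neg_one_even_power neg_one_odd_power by blast
      then show ?thesis
        using homologous_rel_chain_map_uminus[OF rc, folded z_def] that[of 1] that[of "-1"] by auto
    qed
    then show ?thesis
    proof cases
      case same
      have "signed_sum s p z - frag_cmul 2 z = frag_cmul s (chain_map p uminus z - frag_cmul r z)"
      proof -
        have "frag_cmul s (chain_map p uminus z) = frag_cmul s (chain_map p uminus z - frag_cmul r z) + frag_cmul (s * r) z"
          by (simp flip: frag_cmul_distrib2 frag_cmul_cmul)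
        moreover have "frag_cmul 2 z = z + z"
          using frag_cmul_distrib[of 1 1 z] by simp
        ultimately show ?thesis
          using same by (simp add: signed_sum_def mult.commute)
      qed
      then show ?thesis
        using z same by (metis singular_relboundary_cmul)
    next
      case opp
      have "signed_sum s p z - frag_cmul 2 0 = frag_cmul s (chain_map p uminus z - frag_cmul r z)"
      proof -
        have "frag_cmul s (chain_map p uminus z) = frag_cmul s (chain_map p uminus z - frag_cmul r z) + frag_cmul (s * r) z"
          by (simp flip: frag_cmul_distrib2 frag_cmul_cmul)
        then show ?thesis
          using opp by (simp add: signed_sum_def mult.commute)
      qed
      then show ?thesis
        using opp by (metis singular_relboundary_cmul singular_relcycle_0)
    qed
  qed
  then obtain y where y: "singular_relcycle p (nsphere p) {} y"
    and yz: "singular_relboundary p (nsphere p) {} (signed_sum s p z - frag_cmul 2 y)"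
    by blast
  have "singular_relboundary p (nsphere p) {} (signed_sum s p (e p) - frag_cmul 2 (- y))"
  proof -
    have "frag_cmul 2 (- y) = - frag_cmul 2 y"
      using frag_cmul_cmul[of 2 "-1" y] by simp
    then have "signed_sum s p (e p) - frag_cmul 2 (- y)
        = chain_boundary (Suc p) (d (Suc p)) - (signed_sum s p z - frag_cmul 2 y)"
      unfolding sz by (simp add: algebra_simps del: minus_frag_cmul)
    with singular_relboundary_diff[OF bdry yz] show ?thesis
      by (simp only:)
  qed
  moreover have "singular_relcycle p (nsphere p) {} (- y)"
    using y by (simp add: singular_relcycle_minus)
  ultimately show False
    using e[of p] unfolding half_cycle_def s_def by blast
qed

lemma continuous_map_nsphere_mono:
  assumes "m \<le> n"
  shows "continuous_map (nsphere m) (nsphere n) id"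
  using assms
proof (induction rule: dec_induct)
  case (step k)
  have "continuous_map (nsphere k) (nsphere (Suc k)) id"
    by (subst subtopology_nsphere_equator[symmetric]) (simp add: continuous_map_from_subtopology)
  from continuous_map_compose[OF step.IH this] show ?case
    by simp
qed simp

text \<open>If n > m, restricting to the subsphere of dimension m + 1 reduces to consecutive
  dimensions.\<close>

theorem Borsuk_Ulam_nsphere:
  assumes f: "continuous_map (nsphere n) (nsphere m) f"
    and odd: "\<And>x. x \<in> topspace (nsphere n) \<Longrightarrow> f (- x) = - f x"
  shows "n \<le> m"
proof (rule ccontr)
  assume "\<not> n \<le> m"
  then have sub: "continuous_map (nsphere (Suc m)) (nsphere n) id"
    by (intro continuous_map_nsphere_mono) simp
  have "continuous_map (nsphere (Suc m)) (nsphere m) f"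
    using continuous_map_compose[OF sub f] by simp
  moreover have "f (- x) = - f x" if "x \<in> topspace (nsphere (Suc m))" for x
    using sub that by (intro odd) (auto simp: continuous_map_def)
  ultimately show False
    by (rule Borsuk_Ulam_nsphere_Suc)
qed

section \<open>Upper bounds for the regularized cogenus\<close>

text \<open>The product topology is the topology of the function type, so maps on spheres can be
  handled with \<open>continuous_on\<close>.\<close>

lemma nsphere_eq_top_of_set: "nsphere n = top_of_set (topspace (nsphere n))"
  by (simp add: nsphere euclidean_product_topology)

lemma continuous_on_coordinate: "continuous_on S (\<lambda>x :: nat \<Rightarrow> real. x i)"
  by (rule continuous_on_subset[OF continuous_on_product_coordinates]) simp

lemma odd_map_from_sphere_iff:
  "odd_map_from_sphere m A f \<longleftrightarrow>
    continuous_on (topspace (nsphere (m - 1))) f \<and> f \<in> topspace (nsphere (m - 1)) \<rightarrow> A \<and>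
    (\<forall>x \<in> topspace (nsphere (m - 1)). f (- x) = - f x)"
  unfolding odd_map_from_sphere_def odd_on_def
  by (subst nsphere_eq_top_of_set) (auto simp: continuous_map_in_subtopology)

lemma odd_map_from_sphere_mono_dim:
  assumes "odd_map_from_sphere k A f" "m \<le> k"
  shows "odd_map_from_sphere m A f"
proof -
  have "continuous_map (nsphere (m - 1)) (nsphere (k - 1)) id"
    using assms(2) by (intro continuous_map_nsphere_mono) simp
  then have "topspace (nsphere (m - 1)) \<subseteq> topspace (nsphere (k - 1))"
    by (auto simp: continuous_map_def)
  then show ?thesis
    using assms(1) unfolding odd_map_from_sphere_iff by (blast intro: continuous_on_subset)
qed

lemma odd_map_from_sphere_compose:
  assumes f: "odd_map_from_sphere m A f" and A: "symmetric_set A"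
    and g: "continuous_on A g" "g \<in> A \<rightarrow> B" "odd_on A g"
  shows "odd_map_from_sphere m B (g \<circ> f)"
  unfolding odd_map_from_sphere_iff
proof (intro conjI ballI)
  show "continuous_on (topspace (nsphere (m - 1))) (g \<circ> f)"
    using f g(1) by (intro continuous_on_compose) (auto simp: odd_map_from_sphere_iff intro: continuous_on_subset)
  show "g \<circ> f \<in> topspace (nsphere (m - 1)) \<rightarrow> B"
    using f g(2) by (auto simp: odd_map_from_sphere_iff)
  show "(g \<circ> f) (- x) = - (g \<circ> f) x" if "x \<in> topspace (nsphere (m - 1))" for x
    using f g(3) that by (auto simp: odd_map_from_sphere_iff odd_on_def Pi_iff)
qed

lemma sphere_normalization:
  fixes v :: "nat \<Rightarrow> real"
  assumes "i < m" "v i \<noteq> 0"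
  shows "(\<lambda>i. if i < m then v i / sqrt (\<Sum>j<m. (v j)\<^sup>2) else 0) \<in> topspace (nsphere (m - 1))"
proof -
  define r where "r = (\<Sum>j<m. (v j)\<^sup>2)"
  have "r > 0"
    unfolding r_def using assms by (intro sum_pos2[of _ i]) auto
  have m: "{..m - 1} = {..<m}"
    using assms(1) by auto
  have "(\<Sum>i\<le>m - 1. (if i < m then v i / sqrt r else 0)\<^sup>2) = (\<Sum>i<m. (v i)\<^sup>2 / r)"
    unfolding m using \<open>r > 0\<close> by (intro sum.cong) (auto simp: power_divide)
  also have "\<dots> = 1"
    using \<open>r > 0\<close> by (simp add: r_def flip: sum_divide_distrib)
  finally show ?thesis
    unfolding r_def[symmetric] using assms(1) by (auto simp: nsphere)
qed

text \<open>Off their common zeros, the functions F form a nonzero vector of length m. Normalizing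
  it gives an odd map to a sphere, and composing with f gives an odd map between spheres.\<close>

lemma odd_map_from_sphere_bound:
  fixes F :: "nat \<Rightarrow> 'a::real_topological_vector \<Rightarrow> real"
  assumes f: "odd_map_from_sphere k {x. \<exists>i<m. F i x \<noteq> 0} f"
    and cont: "\<And>i. i < m \<Longrightarrow> continuous_on UNIV (F i)"
    and odd: "\<And>i x. i < m \<Longrightarrow> F i (- x) = - F i x"
  shows "k \<le> m"
proof -
  define U where "U = {x. \<exists>i<m. F i x \<noteq> 0}"
  define G where "G x = (\<lambda>i. if i < m then F i x / sqrt (\<Sum>j<m. (F j x)\<^sup>2) else 0)" for x
  have "symmetric_set U"
    by (auto simp: symmetric_set_def U_def odd)
  moreover have "G x \<in> topspace (nsphere (m - 1))" if x: "x \<in> U" for x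
  proof -
    obtain i where "i < m" "F i x \<noteq> 0"
      using x by (auto simp: U_def)
    then show ?thesis
      unfolding G_def by (rule sphere_normalization)
  qed
  moreover have "continuous_on U G"
  proof (rule continuous_on_coordinatewise_then_product)
    fix i
    have "(\<Sum>j<m. (F j x)\<^sup>2) \<noteq> 0" if "x \<in> U" for x
      using that by (auto simp: U_def sum_nonneg_eq_0_iff)
    then show "continuous_on U (\<lambda>x. G x i)"
      unfolding G_def using cont
      by (cases "i < m") (auto intro!: continuous_intros intro: continuous_on_subset)
  qed
  moreover have "odd_on U G"
    unfolding odd_on_def G_def by (auto simp: odd fun_eq_iff)
  ultimately have Gf: "odd_map_from_sphere k (topspace (nsphere (m - 1))) (G \<circ> f)"
    using f unfolding U_def[symmetric] by (intro odd_map_from_sphere_compose[of k U]) auto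
  have "continuous_map (nsphere (k - 1)) (nsphere (m - 1)) (G \<circ> f)"
    using Gf unfolding odd_map_from_sphere_def nsphere_eq_top_of_set[symmetric] by simp
  then have "k - 1 \<le> m - 1"
    by (rule Borsuk_Ulam_nsphere) (use Gf in \<open>auto simp: odd_map_from_sphere_iff\<close>)
  \<comment> \<open>Because of truncated subtraction, the inequality above says nothing useful for m
    = 0. In that case the target of f is empty while its domain is not.\<close>
  moreover have "m \<noteq> 0"
    using f in_topspace_nsphere[of "k - 1"] by (auto simp: odd_map_from_sphere_iff Pi_iff)
  ultimately show ?thesis
    by simp
qed

section \<open>Elementary bounds for the regularized cogenus\<close>

lemma le_reg_cogenus:
  assumes "m \<ge> 1" "\<And>U. U \<in> sym_nbhds A \<Longrightarrow> \<exists>f. odd_map_from_sphere m U f"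
  shows "enat m \<le> reg_cogenus A"
  unfolding reg_cogenus_def using assms by (intro Sup_upper) auto

lemma reg_cogenus_le:
  assumes "U \<in> sym_nbhds A" "\<And>k f. odd_map_from_sphere k U f \<Longrightarrow> k \<le> m"
  shows "reg_cogenus A \<le> enat m"
  unfolding reg_cogenus_def using assms by (intro Sup_least) auto

text \<open>The set where some F is nonzero is itself an admissible neighbourhood of A; it avoids 0
  because odd functions vanish there.\<close>

lemma reg_cogenus_le_coordinates:
  fixes A :: "'a::real_topological_vector set"
  assumes cont: "\<And>i. i < m \<Longrightarrow> continuous_on UNIV (F i)"
    and odd: "\<And>i x. i < m \<Longrightarrow> F i (- x) = - F i x"
    and nz: "\<And>x. x \<in> A \<Longrightarrow> \<exists>i<m. F i x \<noteq> (0::real)"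
  shows "reg_cogenus A \<le> enat m"
proof (rule reg_cogenus_le)
  let ?U = "{x. \<exists>i<m. F i x \<noteq> 0}"
  have "?U = (\<Union>i<m. F i -` (- {0}))"
    by auto
  moreover have "open (F i -` (- {0}))" if "i < m" for i
    using cont[OF that] by (intro open_vimage) auto
  ultimately have "open ?U"
    by auto
  moreover have "F i 0 = 0" if "i < m" for i
    using odd[OF that, of 0] by simp
  then have "?U \<subseteq> - {0}"
    by auto
  ultimately have "openin (top_of_set (- {0})) ?U"
    unfolding openin_open by (intro exI[of _ ?U]) auto
  moreover have "symmetric_set ?U"
    by (auto simp: symmetric_set_def odd)
  ultimately show "?U \<in> sym_nbhds A"
    using nz by (auto simp: sym_nbhds_def)
  show "k \<le> m" if "odd_map_from_sphere k ?U f" for k f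
    using odd_map_from_sphere_bound[OF that cont odd] .
qed

text \<open>An odd map into A is also an odd map into every neighbourhood of A.\<close>

lemma cogenus_le_reg_cogenus: "cogenus A \<le> reg_cogenus A"
  unfolding cogenus_def reg_cogenus_def
proof (rule Sup_subset_mono, safe)
  fix m f
  assume m: "1 \<le> m" and f: "odd_map_from_sphere m A f"
  have "\<exists>f. odd_map_from_sphere m U f" if "U \<in> sym_nbhds A" for U
    using f that by (auto simp: odd_map_from_sphere_iff sym_nbhds_def intro!: exI[of _ f])
  then show "\<exists>m'. enat m = enat m' \<and> 1 \<le> m' \<and> (\<forall>U\<in>sym_nbhds A. \<exists>f. odd_map_from_sphere m' U f)"
    using m by blast
qed

lemma reg_cogenus_empty: "reg_cogenus ({} :: 'a::real_topological_vector set) = 0"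
proof -
  have "\<not> odd_map_from_sphere m ({} :: 'a set) f" for m f
    using in_topspace_nsphere[of "m - 1"] by (auto simp: odd_map_from_sphere_iff Pi_iff)
  moreover have "({} :: 'a set) \<in> sym_nbhds {}"
    by (simp add: sym_nbhds_def symmetric_set_def)
  ultimately have "reg_cogenus ({} :: 'a set) \<le> enat 0"
    by (intro reg_cogenus_le) auto
  then show ?thesis
    by (simp flip: zero_enat_def)
qed

lemma continuous_on_scaleR_topological:
  fixes g :: "'a::topological_space \<Rightarrow> 'b::real_topological_vector"
  assumes "continuous_on S f" "continuous_on S g"
  shows "continuous_on S (\<lambda>x. f x *\<^sub>R g x)"
  using assms unfolding continuous_on_def
  using filterlim_compose[OF tendsto_scaleR_Pair filterlim_Pair] by fastforce

text \<open>The two points of \<open>nsphere 0\<close> are sent to a and -a.\<close>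

lemma one_le_reg_cogenus:
  fixes A :: "'a::real_topological_vector set"
  assumes "a \<in> A" "symmetric_set A"
  shows "1 \<le> reg_cogenus A"
proof -
  have "odd_map_from_sphere 1 A (\<lambda>s. s 0 *\<^sub>R a)"
    unfolding odd_map_from_sphere_iff
  proof (intro conjI ballI)
    show "continuous_on (topspace (nsphere (1 - 1))) (\<lambda>s. s 0 *\<^sub>R a)"
      by (intro continuous_on_scaleR_topological continuous_on_coordinate continuous_on_const)
    show "(\<lambda>s. s 0 *\<^sub>R a) \<in> topspace (nsphere (1 - 1)) \<rightarrow> A"
      using assms by (auto simp: nsphere power2_eq_1_iff symmetric_set_def)
  qed simp
  then have "enat 1 \<le> cogenus A"
    unfolding cogenus_def by (intro Sup_upper) auto
  with cogenus_le_reg_cogenus[of A] show ?thesis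
    by (simp add: one_enat_def) 
qed

section \<open>Finiteness, comparison with the genus, and stability under small
  neighbourhoods\<close>

lemma metrizable_imp_closed_singleton:
  assumes "metrizable_space (euclidean :: 'a::topological_space topology)"
  shows "closed {x :: 'a}"
  using metrizable_imp_t1_space[OF assms] by (simp add: t1_space_closedin_singleton)

lemma continuous_on_odd_part:
  fixes f :: "'a::topological_group_add \<Rightarrow> real"
  assumes "continuous_on UNIV f"
  shows "continuous_on UNIV (\<lambda>x. f x - f (- x))"
proof -
  have "continuous_on UNIV (\<lambda>x. f (- x))"
    by (rule continuous_on_compose2[OF assms]) (auto intro: continuous_intros)
  with assms show ?thesis
    by (rule continuous_on_diff)
qed

text \<open>A Urysohn function separating a from -a has an odd part that is nonzero at a. By
  compactness finitely many such odd parts have no common zero on A, and their number is a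
  bound.\<close>

lemma reg_cogenus_finite:
  fixes A :: "'a::real_topological_vector set"
  assumes X: "metrizable_space (euclidean :: 'a topology)" and A: "nonempty_sym_compact A"
  obtains n where "n \<ge> 1" "reg_cogenus A = enat n"
proof -
  have "\<exists>\<psi> :: 'a \<Rightarrow> real. continuous_on UNIV \<psi> \<and> (\<forall>x. \<psi> (- x) = - \<psi> x) \<and> \<psi> a \<noteq> 0" if "a \<in> A" for a
  proof -
    have "a \<noteq> - a"
    proof
      assume "a = - a"
      then have "2 *\<^sub>R a = 0"
        by (simp add: scaleR_2 eq_neg_iff_add_eq_0)
      then show False
        using that A by (auto simp: nonempty_sym_compact_def)
    qed
    then obtain f :: "'a \<Rightarrow> real" where f: "continuous_map euclidean euclidean f" "f ` {a} \<subseteq> {1}" "f ` {- a} \<subseteq> {0}"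
      using Urysohn_lemma_alt[OF metrizable_imp_normal_space[OF X], of "{a}" "{- a}" 1 0]
        metrizable_imp_closed_singleton[OF X] by (auto simp: disjnt_def)
    have "continuous_on UNIV (\<lambda>x. f x - f (- x))"
      using f(1) by (intro continuous_on_odd_part) simp
    then show ?thesis
      using f by (intro exI[of _ "\<lambda>x. f x - f (- x)"]) auto
  qed
  then obtain \<psi> where \<psi>: "\<And>a. a \<in> A \<Longrightarrow> continuous_on UNIV (\<psi> a :: 'a \<Rightarrow> real)"
    "\<And>a x. a \<in> A \<Longrightarrow> \<psi> a (- x) = - \<psi> a x" "\<And>a. a \<in> A \<Longrightarrow> \<psi> a a \<noteq> 0"
    by metis
  have "compact A"
    using A by (simp add: nonempty_sym_compact_def)
  moreover have "open (\<psi> a -` (- {0}))" if "a \<in> A" for a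
    using \<psi>(1)[OF that] by (intro open_vimage) auto
  moreover have "A \<subseteq> (\<Union>a\<in>A. \<psi> a -` (- {0}))"
    using \<psi>(3) by auto
  ultimately obtain C where C: "C \<subseteq> A" "finite C" "A \<subseteq> (\<Union>a\<in>C. \<psi> a -` (- {0}))"
    by (rule compactE_image)
  obtain h where h: "bij_betw h {0..<card C} C"
    using ex_bij_betw_nat_finite[OF C(2)] by blast
  then have hA: "h i \<in> A" if "i < card C" for i
    using that C(1) by (auto simp: bij_betw_def)
  have "reg_cogenus A \<le> enat (card C)"
  proof (rule reg_cogenus_le_coordinates[where F = "\<lambda>i. \<psi> (h i)"])
    fix x assume "x \<in> A"
    then obtain a where "a \<in> C" "\<psi> a x \<noteq> 0"
      using C(3) by auto
    moreover have "\<exists>i<card C. h i = a"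
      using h \<open>a \<in> C\<close> unfolding bij_betw_def by (metis atLeastLessThan_iff imageE)
    ultimately show "\<exists>i<card C. \<psi> (h i) x \<noteq> 0"
      by auto
  qed (use hA \<psi> in auto)
  then obtain n where n: "reg_cogenus A = enat n"
    using enat_ile by blast
  moreover have "1 \<le> reg_cogenus A"
    using A one_le_reg_cogenus by (auto simp: nonempty_sym_compact_def)
  ultimately show ?thesis
    using that by (simp add: one_enat_def)
qed

text \<open>The coordinates of an odd map from A to the sphere extend to the whole space by Tietze,
  as A is closed. On A the odd part of each extension is twice the coordinate, so there is no common
  zero.\<close>

lemma reg_cogenus_le_genus:
  fixes A :: "'a::real_topological_vector set"
  assumes X: "metrizable_space (euclidean :: 'a topology)" and A: "nonempty_sym_compact A"
  shows "reg_cogenus A \<le> genus A"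
  unfolding genus_def
proof (rule Inf_greatest, safe)
  fix m f
  assume m: "1 \<le> m" and f: "odd_map_to_sphere A m f"
  have closed: "closedin euclidean A"
    using A metrizable_imp_Hausdorff_space[OF X]
    by (intro compactin_imp_closedin) (auto simp: nonempty_sym_compact_def)
  have fS: "f x \<in> topspace (nsphere (m - 1))" if "x \<in> A" for x
    using f that by (auto simp: odd_map_to_sphere_def continuous_map_def)
  have "\<exists>g. continuous_on UNIV g \<and> (\<forall>x\<in>A. g x = f x i)" for i
  proof -
    have "continuous_map (top_of_set A) euclideanreal ((\<lambda>y. y i) \<circ> f)"
      using f continuous_map_compose[OF _ continuous_map_nsphere_projection] unfolding odd_map_to_sphere_def by blast
    then have "\<exists>g. continuous_map euclidean euclidean g \<and> (\<forall>x\<in>A. g x = ((\<lambda>y. y i) \<circ> f) x)"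
      using metrizable_imp_normal_space[OF X] closed unfolding normal_space_iff_Tietze by blast
    then show ?thesis by auto
  qed
  then obtain g where g: "\<And>i. continuous_on UNIV (g i)" "\<And>i x. x \<in> A \<Longrightarrow> g i x = f x i"
    by metis
  show "reg_cogenus A \<le> enat m"
  proof (rule reg_cogenus_le_coordinates[where F = "\<lambda>i x. g i x - g i (- x)"])
    show "continuous_on UNIV (\<lambda>x. g i x - g i (- x))" for i
      by (intro continuous_on_odd_part g)
    fix x assume x: "x \<in> A"
    then have "g i x - g i (- x) = 2 * f x i" for i
      using A f by (auto simp: g nonempty_sym_compact_def symmetric_set_def odd_map_to_sphere_def odd_on_def)
    moreover have "\<exists>i<m. f x i \<noteq> 0"
    proof (rule ccontr)
      assume "\<not> ?thesis"
      then have "(\<Sum>i\<le>m - 1. (f x i)\<^sup>2) = 0"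
        using m by (intro sum.neutral) auto
      then show False
        using fS[OF x] by (simp add: nsphere)
    qed
    ultimately show "\<exists>i<m. g i x - g i (- x) \<noteq> 0"
      by auto
  qed simp
qed

lemma reg_cogenus_upper_semicontinuous:
  fixes A :: "'a::real_topological_vector set"
  assumes X: "metrizable_space (euclidean :: 'a topology)" and A: "nonempty_sym_compact A"
  obtains U where "openin (top_of_set (- {0})) U" "A \<subseteq> U"
    "\<And>A'. A' \<subseteq> U \<Longrightarrow> reg_cogenus A' \<le> reg_cogenus A"
proof -
  obtain n where n: "reg_cogenus A = enat n"
    using reg_cogenus_finite[OF X A] by blast
  \<comment> \<open>Failure of the value n + 1 yields one neighbourhood U without odd maps from the
    n-sphere, and U is a neighbourhood of each of its subsets.\<close>
  have "\<not> enat (Suc n) \<le> reg_cogenus A"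
    by (simp add: n)
  then obtain U where U: "U \<in> sym_nbhds A" and no: "\<And>f. \<not> odd_map_from_sphere (Suc n) U f"
    using le_reg_cogenus[of "Suc n" A] by auto
  have "reg_cogenus A' \<le> enat n" if "A' \<subseteq> U" for A'
  proof (rule reg_cogenus_le)
    show "U \<in> sym_nbhds A'"
      using U that by (simp add: sym_nbhds_def)
    show "k \<le> n" if "odd_map_from_sphere k U f" for k f
      using no odd_map_from_sphere_mono_dim[OF that, of "Suc n"] not_less_eq_eq by blast
  qed
  with U show ?thesis
    using that by (auto simp: sym_nbhds_def n)
qed

section \<open>Images under odd maps\<close>

text \<open>Continuity of addition gives a local margin at each point of K, compactness makes it
  uniform, and local convexity shrinks it to a convex set. Intersecting with the reflected set makes
  it symmetric.\<close>

lemma compact_uniform_nbhd: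
  fixes K V :: "'a::real_topological_vector set"
  assumes lc: "locally_convex TYPE('a)" and K: "compact K" and V: "open V" "K \<subseteq> V"
  obtains W where "open W" "convex W" "0 \<in> W" "\<And>w. w \<in> W \<Longrightarrow> - w \<in> W"
    "\<And>y w. y \<in> K \<Longrightarrow> w \<in> W \<Longrightarrow> y + w \<in> V"
proof -
  have "continuous_on UNIV (\<lambda>p :: 'a \<times> 'a. fst p + snd p)"
    by (intro continuous_intros)
  then have op: "open ((\<lambda>p. fst p + snd p) -` V)"
    using V(1) by (intro open_vimage) auto
  have "\<exists>N M. open N \<and> open M \<and> y \<in> N \<and> 0 \<in> M \<and> (\<forall>y'\<in>N. \<forall>w\<in>M. y' + w \<in> V)" if y: "y \<in> K" for y
  proof -
    have "(y, 0) \<in> (\<lambda>p. fst p + snd p) -` V"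
      using y V(2) by auto
    then obtain N M where "open N" "open M" "(y, 0) \<in> N \<times> M" "N \<times> M \<subseteq> (\<lambda>p. fst p + snd p) -` V"
      using open_prod_elim[OF op] by blast
    then show ?thesis
      by (intro exI[of _ N] exI[of _ M]) auto
  qed
  then have "\<forall>y\<in>K. \<exists>P. open (fst P) \<and> open (snd P) \<and> y \<in> fst P \<and> 0 \<in> snd P \<and>
      (\<forall>y'\<in>fst P. \<forall>w\<in>snd P. y' + w \<in> V)"
    by (simp add: split_paired_Ex)
  then obtain P where P: "\<forall>y\<in>K. open (fst (P y)) \<and> open (snd (P y)) \<and> y \<in> fst (P y) \<and> 0 \<in> snd (P y) \<and>
      (\<forall>y'\<in>fst (P y). \<forall>w\<in>snd (P y). y' + w \<in> V)"
    by (rule bchoice[THEN exE])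
  define N M where "N y = fst (P y)" and "M y = snd (P y)" for y
  have NM: "\<And>y. y \<in> K \<Longrightarrow> open (N y)" "\<And>y. y \<in> K \<Longrightarrow> open (M y)"
    "\<And>y. y \<in> K \<Longrightarrow> y \<in> N y" "\<And>y. y \<in> K \<Longrightarrow> 0 \<in> M y"
    "\<And>y y' w. y \<in> K \<Longrightarrow> y' \<in> N y \<Longrightarrow> w \<in> M y \<Longrightarrow> y' + w \<in> V"
    using P by (simp_all add: N_def M_def)
  have "K \<subseteq> (\<Union>y\<in>K. N y)"
    using NM(3) by auto
  with K NM(1) obtain C where C: "C \<subseteq> K" "finite C" "K \<subseteq> (\<Union>y\<in>C. N y)"
    by (rule compactE_image)
  have "open (\<Inter>y\<in>C. M y)" "0 \<in> (\<Inter>y\<in>C. M y)"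
    using C NM(2,4) by (auto intro!: open_INT)
  then obtain W0 where W0: "open W0" "convex W0" "0 \<in> W0" "W0 \<subseteq> (\<Inter>y\<in>C. M y)"
    using lc unfolding locally_convex_def by metis
  define W where "W = W0 \<inter> uminus -` W0"
  show ?thesis
  proof
    show "open W"
      unfolding W_def using W0(1) by (intro open_Int open_vimage) (auto intro: continuous_intros)
    have "convex (uminus -` W0)"
      using W0(2) by (intro convex_linear_vimage) (auto simp: linear_iff)
    then show "convex W"
      unfolding W_def by (intro convex_Int W0(2))
    show "0 \<in> W" "\<And>w. w \<in> W \<Longrightarrow> - w \<in> W"
      using W0(3) by (auto simp: W_def)
    show "y + w \<in> V" if y: "y \<in> K" and w: "w \<in> W" for y w
    proof -
      obtain c where c: "c \<in> C" "y \<in> N c"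
        using y C(3) by auto
      moreover have "w \<in> M c"
        using w W0(4) c(1) by (auto simp: W_def)
      ultimately show ?thesis
        using NM(5) C(1) by auto
    qed
  qed
qed

text \<open>The points of A whose image is close to that of a form the trace on A of an open set T.
  A Urysohn function equal to 1 at a and 0 off T is the required bump.\<close>

lemma bump_function:
  fixes \<pi> :: "'a::topological_space \<Rightarrow> 'b::real_topological_vector"
  assumes X: "metrizable_space (euclidean :: 'a topology)"
    and cont: "continuous_on A \<pi>" and a: "a \<in> A" and W: "open W" "0 \<in> W"
  obtains \<phi> :: "'a \<Rightarrow> real" where "continuous_on UNIV \<phi>" "\<And>x. \<phi> x \<ge> 0" "\<phi> a > 0"
    "\<And>x. x \<in> A \<Longrightarrow> \<phi> x \<noteq> 0 \<Longrightarrow> \<pi> a - \<pi> x \<in> W"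
proof -
  have "continuous_on A (\<lambda>x. \<pi> a - \<pi> x)"
    by (intro continuous_intros cont)
  then have "openin (top_of_set A) (A \<inter> (\<lambda>x. \<pi> a - \<pi> x) -` W)"
    using W(1) by (rule continuous_openin_preimage_gen)
  then obtain T where T: "open T" "A \<inter> (\<lambda>x. \<pi> a - \<pi> x) -` W = A \<inter> T"
    by (auto simp: openin_open)
  have "a \<in> T"
    using T(2) a W(2) by auto
  then have "disjnt (- T) {a}"
    by (auto simp: disjnt_def)
  then obtain \<phi> where \<phi>: "continuous_map euclidean (top_of_set {0..1::real}) \<phi>" "\<phi> ` (- T) \<subseteq> {0}" "\<phi> ` {a} \<subseteq> {1}"
    using Urysohn_lemma[OF metrizable_imp_normal_space[OF X], of "- T" "{a}" 0 1] T(1)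
      metrizable_imp_closed_singleton[OF X, of a] by auto
  show ?thesis
  proof
    show "continuous_on UNIV \<phi>"
      using \<phi>(1) by (simp add: continuous_map_in_subtopology)
    show "\<phi> x \<ge> 0" for x
      using \<phi>(1) by (auto simp: continuous_map_in_subtopology Pi_iff)
    show "\<phi> a > 0"
      using \<phi>(3) by auto
    show "\<pi> a - \<pi> x \<in> W" if x: "x \<in> A" "\<phi> x \<noteq> 0" for x
    proof -
      have "x \<in> A \<inter> T"
        using x \<phi>(2) by auto
      then show ?thesis
        unfolding T(2)[symmetric] by simp
    qed
  qed
qed

text \<open>The values of \<pi> at finitely many points are averaged with a partition of unity, then
  the average is made odd. Both operations keep the error on A inside the convex symmetric set W, so
  A is still mapped into V.\<close>

lemma odd_map_extension_nbhd:
  fixes A :: "'a::real_topological_vector set" and \<pi> :: "'a \<Rightarrow> 'b::real_topological_vector"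
  assumes X: "metrizable_space (euclidean :: 'a topology)"
    and Y: "metrizable_space (euclidean :: 'b topology)" "locally_convex TYPE('b)"
    and A: "compact A" "symmetric_set A"
    and \<pi>: "continuous_on A \<pi>" "odd_on A \<pi>" and V: "V \<in> sym_nbhds (\<pi> ` A)"
  obtains U g where "U \<in> sym_nbhds A" "continuous_on U g" "g \<in> U \<rightarrow> V" "odd_on U g"
proof -
  have V0: "V \<subseteq> - {0}" "symmetric_set V" "\<pi> ` A \<subseteq> V" and "open V"
  proof -
    have "open (- {0 :: 'b})"
      using metrizable_imp_closed_singleton[OF Y(1)] by (simp add: open_Compl)
    then show "open V" "V \<subseteq> - {0}" "symmetric_set V" "\<pi> ` A \<subseteq> V"
      using V by (auto simp: sym_nbhds_def openin_open_eq)
  qed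
  have "compact (\<pi> ` A)"
    using \<pi>(1) A(1) by (rule compact_continuous_image)
  then obtain W where W: "open W" "convex W" "0 \<in> W" "\<And>w. w \<in> W \<Longrightarrow> - w \<in> W"
    "\<And>y w. y \<in> \<pi> ` A \<Longrightarrow> w \<in> W \<Longrightarrow> y + w \<in> V"
    using compact_uniform_nbhd[OF Y(2) _ \<open>open V\<close> V0(3)] by blast
  have "\<exists>\<phi> :: 'a \<Rightarrow> real. continuous_on UNIV \<phi> \<and> (\<forall>x. \<phi> x \<ge> 0) \<and> \<phi> a > 0 \<and>
      (\<forall>x\<in>A. \<phi> x \<noteq> 0 \<longrightarrow> \<pi> a - \<pi> x \<in> W)" if a: "a \<in> A" for a
    using bump_function[OF X \<pi>(1) a W(1,3)] by metis
  then obtain \<phi> where cont: "\<And>a. a \<in> A \<Longrightarrow> continuous_on UNIV (\<phi> a :: 'a \<Rightarrow> real)"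
    and nonneg: "\<And>a x. a \<in> A \<Longrightarrow> \<phi> a x \<ge> 0" and pos: "\<And>a. a \<in> A \<Longrightarrow> \<phi> a a > 0"
    and near: "\<And>a x. a \<in> A \<Longrightarrow> x \<in> A \<Longrightarrow> \<phi> a x \<noteq> 0 \<Longrightarrow> \<pi> a - \<pi> x \<in> W"
    by metis
  have "open (\<phi> a -` {0<..})" if "a \<in> A" for a
    using cont[OF that] by (intro open_vimage) auto
  moreover have "A \<subseteq> (\<Union>a\<in>A. \<phi> a -` {0<..})"
    using pos by auto
  ultimately obtain C where C: "C \<subseteq> A" "finite C" "A \<subseteq> (\<Union>a\<in>C. \<phi> a -` {0<..})"
    by (rule compactE_image[OF A(1)])
  define S where "S x = (\<Sum>c\<in>C. \<phi> c x)" for x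
  define g0 where "g0 x = (\<Sum>c\<in>C. (\<phi> c x / S x) *\<^sub>R \<pi> c)" for x
  define g where "g x = (1/2) *\<^sub>R (g0 x - g0 (- x))" for x
  \<comment> \<open>Positivity at both x and -x makes \<open>U0\<close> symmetric and both terms of
    g continuous on it.\<close>
  define U0 where "U0 = {x. S x > 0 \<and> S (- x) > 0}"
  have contS: "continuous_on UNIV S"
    unfolding S_def using cont C(1) by (intro continuous_on_sum) auto
  have contS': "continuous_on UNIV (\<lambda>x. S (- x))"
    by (rule continuous_on_compose2[OF contS]) (auto intro: continuous_intros)
  have U0_eq: "U0 = S -` {0<..} \<inter> (\<lambda>x. S (- x)) -` {0<..}"
    by (auto simp: U0_def)
  have "open U0"
    unfolding U0_eq by (intro open_Int open_vimage contS contS') auto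
  have S_pos: "S x > 0" if x: "x \<in> A" for x
  proof -
    obtain c where "c \<in> C" "\<phi> c x > 0"
      using x C(3) by auto
    then show ?thesis
      unfolding S_def using nonneg C(1,2) by (intro sum_pos2[of _ c]) auto
  qed
  have AU0: "A \<subseteq> U0"
    using S_pos A(2) by (auto simp: U0_def symmetric_set_def)
  have cont_g0: "continuous_on {x. S x > 0} g0"
    unfolding g0_def
  proof (intro continuous_on_sum continuous_on_scaleR_topological continuous_on_const)
    fix c assume "c \<in> C"
    then have "continuous_on {x. S x > 0} (\<phi> c)"
      using cont C(1) by (blast intro: continuous_on_subset)
    moreover have "continuous_on {x. S x > 0} S"
      using contS by (rule continuous_on_subset) simp
    ultimately show "continuous_on {x. S x > 0} (\<lambda>x. \<phi> c x / S x)"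
      by (rule continuous_on_divide) auto
  qed
  have cont_g: "continuous_on U0 g"
    unfolding g_def
  proof (intro continuous_on_scaleR_topological continuous_on_const continuous_on_diff)
    show "continuous_on U0 g0"
      by (rule continuous_on_subset[OF cont_g0]) (auto simp: U0_def)
    show "continuous_on U0 (\<lambda>x. g0 (- x))"
      by (rule continuous_on_compose2[OF cont_g0]) (auto simp: U0_def intro: continuous_intros)
  qed
  have odd_g: "g (- x) = - g x" for x
    by (simp add: g_def flip: scaleR_minus_right)
  have g0_near: "g0 x - \<pi> x \<in> W" if x: "x \<in> A" for x
  proof -
    \<comment> \<open>Centres with weight zero at x need not have image close to that of x, so they
      are discarded before convexity is used.\<close>
    define C' where "C' = {c \<in> C. \<phi> c x \<noteq> 0}"
    have C': "C' \<subseteq> C" "finite C'"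
      using C(2) by (auto simp: C'_def)
    have sum1: "(\<Sum>c\<in>C'. \<phi> c x / S x) = 1"
    proof -
      have "(\<Sum>c\<in>C'. \<phi> c x) = S x"
        unfolding S_def by (rule sum.mono_neutral_left) (use C(2) in \<open>auto simp: C'_def\<close>)
      then show ?thesis
        using S_pos[OF x] by (simp flip: sum_divide_distrib)
    qed
    have "g0 x = (\<Sum>c\<in>C'. (\<phi> c x / S x) *\<^sub>R \<pi> c)"
      unfolding g0_def by (rule sum.mono_neutral_right) (use C(2) in \<open>auto simp: C'_def\<close>)
    moreover have "\<pi> x = (\<Sum>c\<in>C'. (\<phi> c x / S x) *\<^sub>R \<pi> x)"
      using sum1 by (simp flip: scaleR_left.sum)
    ultimately have "g0 x - \<pi> x = (\<Sum>c\<in>C'. (\<phi> c x / S x) *\<^sub>R (\<pi> c - \<pi> x))"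
      by (simp add: scaleR_diff_right sum_subtractf)
    also have "\<dots> \<in> W"
    proof (rule convex_sum[OF C'(2) W(2) sum1])
      show "\<phi> c x / S x \<ge> 0" if "c \<in> C'" for c
        using that C' C(1) nonneg S_pos[OF x] by (auto intro!: divide_nonneg_pos)
      show "\<pi> c - \<pi> x \<in> W" if "c \<in> C'" for c
        using that C(1) x by (intro near) (auto simp: C'_def)
    qed
    finally show ?thesis .
  qed
  have g_V: "g x \<in> V" if x: "x \<in> A" for x
  proof -
    \<comment> \<open>The error of g at x is the midpoint of the error of \<open>g0\<close> at x and
      the negated error at -x.\<close>
    have "- x \<in> A" and "\<pi> (- x) = - \<pi> x"
      using x A(2) \<pi>(2) by (auto simp: symmetric_set_def odd_on_def)
    then have "(1/2) *\<^sub>R (g0 x - \<pi> x) + (1/2) *\<^sub>R (- (g0 (- x) - \<pi> (- x))) \<in> W"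
      using g0_near[OF x] W(4)[OF g0_near, of "- x"] by (intro convexD[OF W(2)]) auto
    moreover have "(1/2) *\<^sub>R (g0 x - \<pi> x) + (1/2) *\<^sub>R (- (g0 (- x) - \<pi> (- x))) = g x - \<pi> x"
    proof -
      have "(1/2) *\<^sub>R \<pi> x + (1/2) *\<^sub>R \<pi> x = \<pi> x"
        by (simp flip: scaleR_left_distrib)
      then show ?thesis
        unfolding g_def \<open>\<pi> (- x) = - \<pi> x\<close> by (simp add: algebra_simps)
    qed
    ultimately have "\<pi> x + (g x - \<pi> x) \<in> V"
      using x by (intro W(5)) auto
    then show ?thesis by simp
  qed
  \<comment> \<open>Pulling back V forces g to map U into V. The origin is excluded because g
    vanishes there and V avoids 0.\<close>
  define U where "U = U0 \<inter> g -` V"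
  have "open U"
    unfolding U_def using continuous_open_preimage[OF cont_g \<open>open U0\<close> \<open>open V\<close>] .
  have "0 \<notin> U"
    using V0(1) by (auto simp: U_def g_def)
  then have "openin (top_of_set (- {0})) U"
    unfolding openin_open using \<open>open U\<close> by (intro exI[of _ U]) auto
  moreover have "symmetric_set U"
    using V0(2) by (auto simp: symmetric_set_def U_def U0_def odd_g)
  moreover have "A \<subseteq> U"
    using AU0 g_V by (auto simp: U_def)
  ultimately have "U \<in> sym_nbhds A"
    by (simp add: sym_nbhds_def)
  moreover have "continuous_on U g"
    using cont_g by (rule continuous_on_subset) (simp add: U_def)
  moreover have "g \<in> U \<rightarrow> V"
    by (auto simp: U_def)
  moreover have "odd_on U g"
    by (simp add: odd_on_def odd_g)
  ultimately show ?thesis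
    by (rule that)
qed

lemma reg_cogenus_odd_image:
  fixes A :: "'a::real_topological_vector set" and \<pi> :: "'a \<Rightarrow> 'b::real_topological_vector"
  assumes "metrizable_space (euclidean :: 'a topology)"
    and "metrizable_space (euclidean :: 'b topology)" "locally_convex TYPE('b)"
    and "compact A" "symmetric_set A" "continuous_on A \<pi>" "odd_on A \<pi>"
  shows "reg_cogenus A \<le> reg_cogenus (\<pi> ` A)"
proof -
  have "\<exists>f. odd_map_from_sphere m V f"
    if m: "\<forall>U\<in>sym_nbhds A. \<exists>f. odd_map_from_sphere m U f" and V: "V \<in> sym_nbhds (\<pi> ` A)" for m V
  proof -
    obtain U g where U: "U \<in> sym_nbhds A" and g: "continuous_on U g" "g \<in> U \<rightarrow> V" "odd_on U g"
      using odd_map_extension_nbhd[OF assms V] by metis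
    obtain f where f: "odd_map_from_sphere m U f"
      using m U by blast
    have "odd_map_from_sphere m V (g \<circ> f)"
      using U by (intro odd_map_from_sphere_compose[OF f _ g]) (simp add: sym_nbhds_def)
    then show ?thesis by blast
  qed
  then show ?thesis
    unfolding reg_cogenus_def by (intro Sup_subset_mono) blast
qed

section \<open>Unit spheres of normed spaces\<close>

text \<open>The sphere is a closed subset of the cube of sequences with entries in [-1, 1], which is
  compact by Tychonoff.\<close>

lemma compact_topspace_nsphere: "compact (topspace (nsphere n))"
proof -
  have "compactin (powertop_real UNIV) (PiE UNIV (\<lambda>_. {-1..1}))"
    by (subst compactin_PiE) auto
  then have box: "compact (PiE UNIV (\<lambda>_::nat. {-1..1::real}))"
    by (simp add: euclidean_product_topology)
  have eq: "topspace (nsphere n) = {x. (\<Sum>i\<le>n. (x i)\<^sup>2) = 1} \<inter> (\<Inter>i\<in>{n<..}. {x. x i = 0})"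
    by (auto simp: nsphere)
  have "closed (topspace (nsphere n))"
    unfolding eq
    by (intro closed_Int closed_INT ballI closed_Collect_eq continuous_intros continuous_on_coordinate)
  moreover have "topspace (nsphere n) \<subseteq> PiE UNIV (\<lambda>_. {-1..1})"
  proof
    fix x assume x: "x \<in> topspace (nsphere n)"
    have "\<bar>x k\<bar> \<le> 1" for k
      using topspace_nsphere_1[OF x, of k] by (simp add: abs_square_le_1)
    then show "x \<in> PiE UNIV (\<lambda>_. {-1..1})"
      by (auto simp: abs_le_iff minus_le_iff)
  qed
  ultimately show ?thesis
    using compact_Int_closed[OF box, of "topspace (nsphere n)"] by (simp add: inf.absorb2)
qed

lemma finite_dim_coordinates:
  assumes "\<exists>B :: 'n::real_normed_vector set. finite B \<and> span B = UNIV"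
  obtains b :: "nat \<Rightarrow> 'n::real_normed_vector" and r :: "nat \<Rightarrow> 'n::real_normed_vector \<Rightarrow> real" where
    "\<And>i. linear (r i)" "\<And>u. u = (\<Sum>i<dim (UNIV :: 'n::real_normed_vector set). r i u *\<^sub>R b i)"
    "\<And>s i. i < dim (UNIV :: 'n::real_normed_vector set) \<Longrightarrow> r i (\<Sum>i<dim (UNIV :: 'n::real_normed_vector set). s i *\<^sub>R b i) = s i"
proof -
  obtain B0 :: "'n set" where B0: "finite B0" "span B0 = UNIV"
    using assms by blast
  obtain B :: "'n set" where B: "independent B" "UNIV \<subseteq> span B" "card B = dim (UNIV :: 'n set)"
    by (rule basis_exists)
  have fin: "finite B"
    using independent_span_bound[OF B0(1) B(1)] B0(2) by simp
  have span: "u \<in> span B" for u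
    using B(2) by auto
  define d where "d = dim (UNIV :: 'n set)"
  obtain b where b: "bij_betw b {..<d} B"
    using bij_betw_from_nat_into_finite[OF fin] B(3) d_def by auto
  define r where "r i u = representation B u (b i)" for i u
  show ?thesis
  proof (rule that[of r b, folded d_def])
    show "linear (r i)" for i
      by (rule linearI) (simp_all add: r_def representation_add representation_scale B(1) span)
    show expand: "u = (\<Sum>i<d. r i u *\<^sub>R b i)" for u
    proof -
      have "(\<Sum>i<d. r i u *\<^sub>R b i) = (\<Sum>v\<in>B. representation B u v *\<^sub>R v)"
        unfolding r_def by (rule sum.reindex_bij_betw[OF b])
      also have "\<dots> = u"
        by (rule sum_representation_eq[OF B(1) span fin]) simp
      finally show ?thesis ..
    qed
    show "r i (\<Sum>i<d. s i *\<^sub>R b i) = s i" if i: "i < d" for s i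
    proof -
      have bB: "b j \<in> B" if "j < d" for j
        using b that by (auto simp: bij_betw_def)
      have "r i (\<Sum>i<d. s i *\<^sub>R b i) = (\<Sum>j<d. s j * r i (b j))"
        unfolding r_def by (simp add: representation_sum representation_scale B(1) span)
      also have "\<dots> = (\<Sum>j<d. if j = i then s j else 0)"
      proof (rule sum.cong)
        fix j assume "j \<in> {..<d}"
        then have "b i = b j \<longleftrightarrow> j = i"
          using b i by (auto simp: bij_betw_def inj_on_def)
        then show "s j * r i (b j) = (if j = i then s j else 0)"
          using \<open>j \<in> {..<d}\<close> by (simp add: r_def representation_basis[OF B(1) bB])
      qed simp
      finally show ?thesis
        using i by simp
    qed
  qed
qed

text \<open>The linear coordinates are odd and vanish simultaneously only at 0, which gives the
  upper bound. Radial projection of the linear parametrization gives the lower bound.\<close>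

lemma reg_cogenus_unit_sphere:
  assumes fd: "\<exists>B :: 'n::real_normed_vector set. finite B \<and> span B = UNIV"
    and dim: "1 \<le> dim (UNIV :: 'n set)"
  shows "reg_cogenus {u :: 'n. norm u = 1} = enat (dim (UNIV :: 'n set))"
proof -
  define d where "d = dim (UNIV :: 'n set)"
  obtain b :: "nat \<Rightarrow> 'n" and r :: "nat \<Rightarrow> 'n \<Rightarrow> real" where lin: "\<And>i. linear (r i)"
    and expand: "\<And>u. u = (\<Sum>i<d. r i u *\<^sub>R b i)"
    and coord: "\<And>s i. i < d \<Longrightarrow> r i (\<Sum>i<d. s i *\<^sub>R b i) = s i"
    by (rule finite_dim_coordinates[OF fd, folded d_def]) blast
  define T where "T s = (\<Sum>i<d. s i *\<^sub>R b i)" for s :: "nat \<Rightarrow> real"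
  define S where "S = topspace (nsphere (d - 1))"
  have d: "{..d - 1} = {..<d}"
    using dim by (auto simp: d_def)
  have contT: "continuous_on A T" for A
    unfolding T_def by (intro continuous_intros continuous_on_coordinate)
  have T_nz: "T s \<noteq> 0" if s: "s \<in> S" for s
  proof
    assume "T s = 0"
    then have "s i = 0" if "i < d" for i
      using coord[OF that, of s] linear_0[OF lin] by (simp add: T_def)
    then have "(\<Sum>i\<le>d - 1. (s i)\<^sup>2) = 0"
      unfolding d by simp
    then show False
      using s by (simp add: S_def nsphere)
  qed
  have T_minus: "T (- s) = - T s" for s
    by (simp add: T_def sum_negf)
  have "compact S" "S \<noteq> {}"
    unfolding S_def using compact_topspace_nsphere in_topspace_nsphere by auto
  then obtain s0 where s0: "s0 \<in> S" "\<And>s. s \<in> S \<Longrightarrow> norm (T s0) \<le> norm (T s)"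
    using continuous_attains_inf[OF _ _ continuous_on_norm[OF contT], of S] by blast
  define c where "c = norm (T s0)"
  have "c > 0"
    using T_nz[OF s0(1)] by (simp add: c_def)
  \<comment> \<open>Continuity of the coordinates: c is the minimum of the norm over the image of
    the Euclidean sphere and is positive by compactness. Writing u as \<rho> times the image of a
    unit vector s gives \<rho> * c \<le> norm u, and each coordinate is at most \<rho> in absolute
    value.\<close>
  have bound: "norm (r i u) \<le> norm u * (1 / c)" if i: "i < d" for i u
  proof (cases "r i u = 0")
    case False
    define v where "v = (\<lambda>j. r j u)"
    define \<rho> where "\<rho> = sqrt (\<Sum>j<d. (r j u)\<^sup>2)"
    define s where "s = (\<lambda>j. if j < d then v j / sqrt (\<Sum>j<d. (v j)\<^sup>2) else 0)"
    have s: "s \<in> S"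
      unfolding S_def s_def by (rule sphere_normalization[of i]) (use i False in \<open>auto simp: v_def\<close>)
    have "\<rho> > 0"
      unfolding \<rho>_def using i False by (intro real_sqrt_gt_zero sum_pos2[of _ i]) auto
    have "\<rho> *\<^sub>R T s = (\<Sum>j<d. r j u *\<^sub>R b j)"
      unfolding T_def scaleR_sum_right
      using \<open>\<rho> > 0\<close> by (intro sum.cong) (auto simp: s_def v_def simp flip: \<rho>_def)
    then have "norm u = \<rho> * norm (T s)"
      using \<open>\<rho> > 0\<close> expand[of u] by (metis abs_of_pos norm_scaleR)
    then have "\<rho> * c \<le> norm u"
      using s0(2)[OF s] \<open>\<rho> > 0\<close> by (simp add: c_def)
    moreover have "\<bar>r i u\<bar> \<le> \<rho>"
    proof -
      have "(r i u)\<^sup>2 \<le> (\<Sum>j<d. (r j u)\<^sup>2)"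
        using i by (intro member_le_sum) auto
      then show ?thesis
        unfolding \<rho>_def by (simp add: real_le_rsqrt)
    qed
    ultimately have "\<bar>r i u\<bar> * c \<le> norm u"
      using \<open>c > 0\<close> by (meson mult_right_mono less_imp_le order_trans)
    then show ?thesis
      using \<open>c > 0\<close> by (simp add: field_simps)
  qed (use \<open>c > 0\<close> in simp)
  have "reg_cogenus {u :: 'n. norm u = 1} \<le> enat d"
  proof (rule reg_cogenus_le_coordinates[where F = r])
    show "continuous_on UNIV (r i)" if "i < d" for i
    proof -
      have "bounded_linear (r i)"
        by (rule bounded_linear_intro[OF _ _ bound[OF that]])
          (simp_all add: linear_add[OF lin] linear_scale[OF lin])
      then show ?thesis
        by (rule linear_continuous_on)
    qed
    show "r i (- x) = - r i x" for i x
      by (rule linear_neg[OF lin])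
    show "\<exists>i<d. r i x \<noteq> 0" if x: "x \<in> {u. norm u = 1}" for x
    proof (rule ccontr)
      assume "\<not> ?thesis"
      then have "x = 0"
        using expand[of x] by simp
      then show False
        using x by simp
    qed
  qed
  moreover have "enat d \<le> cogenus {u :: 'n. norm u = 1}"
  proof -
    have "odd_map_from_sphere d {u :: 'n. norm u = 1} (\<lambda>s. (1 / norm (T s)) *\<^sub>R T s)"
      unfolding odd_map_from_sphere_iff S_def[symmetric]
      by (auto simp: T_nz T_minus intro!: continuous_intros contT)
    then show ?thesis
      unfolding cogenus_def using dim by (intro Sup_upper) (auto simp: d_def)
  qed
  ultimately show ?thesis
    using cogenus_le_reg_cogenus[of "{u :: 'n. norm u = 1}"] unfolding d_def by (meson order_antisym order_trans)
qed

theorem lemma1p3: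
  assumes "metrizable_space (euclidean :: 'x::real_topological_vector topology)" "locally_convex TYPE('x)"
    and "metrizable_space (euclidean :: 'y::real_topological_vector topology)" "locally_convex TYPE('y)"
  shows
    "(reg_cogenus ({} :: 'x set) = 0 \<and>
      (\<forall>A :: 'x set. nonempty_sym_compact A \<longrightarrow> (\<exists>n::nat. n \<ge> 1 \<and> reg_cogenus A = enat n)))
     \<and>
     (\<forall>(A :: 'x set) (\<pi> :: 'x \<Rightarrow> 'y).
        nonempty_sym_compact A \<and> continuous_on A \<pi> \<and> \<pi> ` A \<subseteq> - {0} \<and> odd_on A \<pi> \<longrightarrow>
        reg_cogenus (\<pi> ` A) \<ge> reg_cogenus A)
     \<and>
     (\<forall>A :: 'x set. nonempty_sym_compact A \<longrightarrow>
        (\<exists>U. openin (top_of_set (- {0})) U \<and> A \<subseteq> U \<and>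
           (\<forall>A'. nonempty_sym_compact A' \<and> A' \<subseteq> U \<longrightarrow> reg_cogenus A' \<le> reg_cogenus A)))
     \<and>
     ((\<exists>B :: 'n::real_normed_vector set. finite B \<and> span B = UNIV) \<and> 1 \<le> dim (UNIV :: 'n set) \<longrightarrow>
        reg_cogenus {u :: 'n. norm u = 1} = enat (dim (UNIV :: 'n set)))
     \<and>
     (\<forall>A :: 'x set. nonempty_sym_compact A \<longrightarrow>
        cogenus A \<le> reg_cogenus A \<and> reg_cogenus A \<le> genus A)"
proof (intro conjI allI impI)
  show "reg_cogenus ({} :: 'x set) = 0"
    by (rule reg_cogenus_empty)
next
  fix A :: "'x set"
  assume A: "nonempty_sym_compact A"
  show "\<exists>n::nat. n \<ge> 1 \<and> reg_cogenus A = enat n"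
    using reg_cogenus_finite[OF assms(1) A] by blast
  show "\<exists>U. openin (top_of_set (- {0})) U \<and> A \<subseteq> U \<and>
      (\<forall>A'. nonempty_sym_compact A' \<and> A' \<subseteq> U \<longrightarrow> reg_cogenus A' \<le> reg_cogenus A)"
    by (rule reg_cogenus_upper_semicontinuous[OF assms(1) A]) blast
  show "cogenus A \<le> reg_cogenus A"
    by (rule cogenus_le_reg_cogenus)
  show "reg_cogenus A \<le> genus A"
    by (rule reg_cogenus_le_genus[OF assms(1) A])
next
  fix A :: "'x set" and \<pi> :: "'x \<Rightarrow> 'y"
  assume "nonempty_sym_compact A \<and> continuous_on A \<pi> \<and> \<pi> ` A \<subseteq> - {0} \<and> odd_on A \<pi>"
  then show "reg_cogenus (\<pi> ` A) \<ge> reg_cogenus A"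
    using assms by (intro reg_cogenus_odd_image) (auto simp: nonempty_sym_compact_def)
next
  assume "(\<exists>B :: 'n set. finite B \<and> span B = UNIV) \<and> 1 \<le> dim (UNIV :: 'n set)"
  then show "reg_cogenus {u :: 'n. norm u = 1} = enat (dim (UNIV :: 'n set))"
    using reg_cogenus_unit_sphere by blast
qed

end
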